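(* Let $F(x,y) = a_0x^4 + a_1x^3y + a_2x^2y^2 + a_3xy^3 + a_4y^4 \in \mathbb{Z}[x,y]$ be a binary quartic form irreducible over $\mathbb{Q}$ with invariants $I = I_F > 0$ and $J = J_F = 0$. Suppose that all four roots of $F(X,1)$ are real, and let $h$ be an integer satisfying $h = \frac{\sqrt{3}\, I^{1/2-\epsilon}}{\pi}$ with $0<\epsilon<\frac12$. Then the Thue inequality $$|F(x,y)| \leq h$$ has at most $$4\left[\frac{\log\left(\frac{1}{2\epsilon} - \frac12\right)}{\log 3}\right] + 16$$ solutions in coprime integers $x, y$ with $y \neq 0$, where $[\cdot]$ denotes the greatest integer function and $(x,y)$ and $(-x,-y)$ are counted as one solution.
   Context: For a binary quartic form $F(x,y) = a_0x^4 + a_1x^3y + a_2x^2y^2 + a_3xy^3 + a_4y^4$, the invariants are $I_F = a_2^2 - 3a_1a_3 + 12a_0a_4$ and $J_F = 2a_2^3 - 9a_1a_2a_3 + 27a_1^2a_4 - 72a_0a_2a_4 + 27a_0a_3^2$. *)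

theory Defs
  imports Complex_Main "HOL-Computational_Algebra.Computational_Algebra"
begin

text \<open>
  The form F(x,y) with integer coefficients, evaluated in an arbitrary commutative ring.
  Taking x, y in the integers gives the values F(x,y); taking the two indeterminates
  of a bivariate polynomial ring gives F itself as a polynomial.
\<close>

definition quartic_form :: "int \<Rightarrow> int \<Rightarrow> int \<Rightarrow> int \<Rightarrow> int \<Rightarrow> 'a::comm_ring_1 \<Rightarrow> 'a \<Rightarrow> 'a" where
  "quartic_form a0 a1 a2 a3 a4 x y =
     of_int a0 * x ^ 4 + of_int a1 * x ^ 3 * y + of_int a2 * x ^ 2 * y ^ 2
     + of_int a3 * x * y ^ 3 + of_int a4 * y ^ 4"

definition quartic_I :: "int \<Rightarrow> int \<Rightarrow> int \<Rightarrow> int \<Rightarrow> int \<Rightarrow> int" where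
  "quartic_I a0 a1 a2 a3 a4 = a2 ^ 2 - 3 * a1 * a3 + 12 * a0 * a4"

definition quartic_J :: "int \<Rightarrow> int \<Rightarrow> int \<Rightarrow> int \<Rightarrow> int \<Rightarrow> int" where
  "quartic_J a0 a1 a2 a3 a4 =
     2 * a2 ^ 3 - 9 * a1 * a2 * a3 + 27 * a1 ^ 2 * a4 - 72 * a0 * a2 * a4 + 27 * a0 * a3 ^ 2"

text \<open>
  The ring of polynomials in x and y over the rationals is represented as \<^typ>\<open>rat poly poly\<close>,
  where x is the inner indeterminate \<^term>\<open>[:[:0, 1:]:]\<close> and y the outer one \<^term>\<open>[:0, 1:]\<close>.
\<close>

definition quartic_irreducible_over_rat :: "int \<Rightarrow> int \<Rightarrow> int \<Rightarrow> int \<Rightarrow> int \<Rightarrow> bool" where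
  "quartic_irreducible_over_rat a0 a1 a2 a3 a4 \<longleftrightarrow>
     irreducible (quartic_form a0 a1 a2 a3 a4 [:[:0, 1:]:] [:0, 1:] :: rat poly poly)"

text \<open>
  Solutions of |F(x,y)| \<open>\<le>\<close> h in coprime integers with y nonzero, as classes
  {(x,y), (-x,-y)}, so that (x,y) and (-x,-y) count once.
\<close>

definition thue_solutions :: "int \<Rightarrow> int \<Rightarrow> int \<Rightarrow> int \<Rightarrow> int \<Rightarrow> int \<Rightarrow> (int \<times> int) set set" where
  "thue_solutions a0 a1 a2 a3 a4 h =
     {{(x, y), (- x, - y)} | x y.
        coprime x y \<and> y \<noteq> 0 \<and> \<bar>quartic_form a0 a1 a2 a3 a4 x y\<bar> \<le> h}"

end

theory Submission imports Defs "HOL-Analysis.Complex_Transcendental" begin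

text \<open>
  When \<open>J = 0\<close> the quartic is, up to a scalar, the imaginary part of the fourth power of a complex
  linear form \<open>\<xi>\<close> on the integer lattice, normalised to have covolume 1. Hence a solution is a
  primitive lattice point whose argument is close to a multiple of \<open>\<pi>/4\<close>, and up to sign the
  solutions fall into four classes, one for each of these directions.

  Within one class, points are sparse because two independent lattice points have determinant at
  least 1, so the modulus of each point exceeds a constant times the cube of the preceding one. On the
  other hand the lattice is closed under multiplication by \<open>\<xi>(x,y)\<^sup>4\<close>, suitably scaled, so the
  diagonal Pade approximants of \<open>w\<^sup>1\<^sup>/\<^sup>4\<close> at 1 turn one large point into a sequence of lattice points
  that approximate the direction of the class extremely well, and comparing them with a second large
  point of the class gives a contradiction. So all points of a class but the last are smaller than a
  power of \<open>I\<close>, and cubing reaches this power in about \<open>log (1/(2\<epsilon>)) / log 3\<close> steps.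
\<close>

section \<open>Pade approximants of the fourth root on the unit circle\<close>

text \<open>The bound 4 (j + 3), where \<open>j\<close> is the floor plus one, allows only
  \<open>j + 2\<close> small points and one large point in a class, so constants cannot be wasted.
  Three savings make this possible. The apolar quadratic form is taken primitive; then
  \<open>3 * E\<close> divides \<open>4 * quartic_I\<close>, which keeps the scale \<open>Q\<close>
  of all integrality statements below two thirds of the invariant. The Pade polynomial is expanded
  about the point of approximation, so that its denominators cost \<open>2 ^ r\<close> instead of
  \<open>8 ^ r\<close>, and this power is absorbed into \<open>Q\<close>. Finally, the first points
  of a class are too small for cubing to gain anything when constants are lost, so their sizes are
  read off numerically from signs and determinants; if \<open>j = 0\<close>, a start is possible
  only because \<open>h\<close>, being a positive integer, keeps \<open>I\<close> away from
  1.\<close>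

text \<open>
  For \<open>w = exp (- 2 i \<alpha>)\<close> the polynomial \<open>\<Sum>j\<le>r. pade r j * w\<^sup>j\<close> times \<open>exp (i (r + 1/4) \<alpha>)\<close>
  has imaginary part \<open>pade_sin r \<alpha>\<close>, which is the Pade remainder, and real part \<open>pade_cos r \<alpha>\<close>.
\<close>

definition pade :: "nat \<Rightarrow> nat \<Rightarrow> real" where
  "pade r j = (real r + 1/4 gchoose j) * (real r - 1/4 gchoose (r - j))"

definition pade_sin :: "nat \<Rightarrow> real \<Rightarrow> real" where
  "pade_sin r \<alpha> = (\<Sum>j\<le>r. pade r j * sin ((real r + 1/4 - 2 * real j) * \<alpha>))"

definition pade_cos :: "nat \<Rightarrow> real \<Rightarrow> real" where
  "pade_cos r \<alpha> = (\<Sum>j\<le>r. pade r j * cos ((real r + 1/4 - 2 * real j) * \<alpha>))"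

text \<open>The leading coefficient of \<open>pade_sin r\<close> at 0, up to sign.\<close>

fun pade_const :: "nat \<Rightarrow> real" where
  "pade_const 0 = 1/4"
| "pade_const (Suc r) =
     2 * ((real r + 1)^2 - 1/16) / ((real r + 1) * (2 * real r + 3)) * pade_const r"

lemma gbinomial_nonneg':
  assumes "real j \<le> x + 1" "x \<ge> 0"
  shows "(x gchoose j) \<ge> (0::real)"
  unfolding gbinomial_prod_rev
  using assms by (intro divide_nonneg_nonneg prod_nonneg) auto

lemma pade_nonneg: "j \<le> r \<Longrightarrow> pade r j \<ge> 0"
\<comment> \<open>For \<open>r = 0\<close> the top \<open>real r - 1/4\<close> is negative and
  outside the reach of \<open>gbinomial_nonneg'\<close>; the only coefficient is then 1.\<close>
proof (cases "r = 0")
  case False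
  assume "j \<le> r"
  then show ?thesis unfolding pade_def
    using False by (intro mult_nonneg_nonneg gbinomial_nonneg') auto
qed (auto simp: pade_def)

lemma sum_pade: "(\<Sum>j\<le>r. pade r j) = real (2 * r choose r)"
proof -
  have "(\<Sum>j\<le>r. pade r j) = (real r + 1/4 + (real r - 1/4) gchoose r)"
    unfolding pade_def gbinomial_Vandermonde [symmetric] by (simp add: atMost_atLeast0)
  also have "\<dots> = real (2 * r choose r)"
    by (simp add: binomial_gbinomial)
  finally show ?thesis .
qed

lemma abs_pade_cos_le: "\<bar>pade_cos r \<alpha>\<bar> \<le> real (2 * r choose r)"
proof -
  have "\<bar>pade_cos r \<alpha>\<bar> \<le> (\<Sum>j\<le>r. \<bar>pade r j * cos ((real r + 1/4 - 2 * real j) * \<alpha>)\<bar>)"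
    unfolding pade_cos_def by (rule sum_abs)
  also have "\<dots> \<le> (\<Sum>j\<le>r. pade r j)"
    by (intro sum_mono) (auto simp: abs_mult pade_nonneg intro: mult_left_le)
  finally show ?thesis by (simp add: sum_pade)
qed

text \<open>With \<open>pade_Suc_Suc\<close> this is the comparison of cosine coefficients behind
  \<open>pade_sin_deriv\<close>: differentiation multiplies a coefficient by its frequency, while
  multiplication by \<open>sin \<alpha>\<close> shifts frequencies by one and so joins two
  neighbours. The extreme frequencies have one neighbour only.\<close>

lemma pade_Suc_0:
  "(real r + 1) * (pade (Suc r) 0 * (real r + 5/4))
     = (real r + 5/4) * (real r + 3/4) * pade r 0"
proof -
  have "(real r + 1) * (real r + 3/4 gchoose Suc r) = (real r + 3/4) * (real r - 1/4 gchoose r)"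
    using gbinomial_absorption [of r "real r + 3/4"] by (simp add: algebra_simps)
  moreover have "pade (Suc r) 0 = (real r + 3/4 gchoose Suc r)" "pade r 0 = (real r - 1/4 gchoose r)"
    by (simp_all add: pade_def add.commute)
  ultimately show ?thesis
    by (metis (no_types, opaque_lifting) mult.assoc mult.commute)
qed

text \<open>The guard \<open>i < r\<close> is essential: by truncated subtraction
  \<open>pade r (Suc r)\<close> is not 0. Absorption expresses all four binomials through
  \<open>c\<close> and \<open>d\<close>, and a polynomial identity remains.\<close>

lemma pade_Suc_Suc:
  assumes "i \<le> r"
  shows "(real r + 1) * (pade (Suc r) (Suc i) * (real r + 5/4 - 2 * real (Suc i)))
     = (real r + 5/4) * (real r + 3/4) * ((if i < r then pade r (Suc i) else 0) - pade r i)"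
proof -
  define x y j where "x = real r + 5/4" and "y = real r + 3/4" and "j = Suc i"
  define c d where "c = (x gchoose j)" and "d = (y gchoose (Suc r - j))"
  have sub: "real (Suc r - j) = real r + 1 - real j" using assms by (simp add: j_def of_nat_diff)
  have 1: "real j * c = x * (x - 1 gchoose i)"
    using gbinomial_absorption [of i x] by (simp add: c_def j_def)
  have 2: "(x - real j) * c = x * (x - 1 gchoose j)"
    using gbinomial_absorb_comp [of x j] by (simp add: c_def)
  have 3: "(y - (real r + 1 - real j)) * d = y * (y - 1 gchoose (r - i))"
    using gbinomial_absorb_comp [of y "Suc r - j"] sub by (simp add: d_def j_def)
  have 4: "(real r + 1 - real j) * d = y * (if i < r then (y - 1 gchoose (r - j)) else 0)"
  proof (cases "i < r")
    case True
    then have "Suc r - j = Suc (r - j)" by (auto simp: j_def)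
    then show ?thesis using gbinomial_absorption [of "r - j" y] sub True
      by (simp add: d_def of_nat_diff algebra_simps)
  next
    case False
    then show ?thesis using sub assms by (simp add: j_def)
  qed
  have p1: "pade (Suc r) (Suc i) = c * d"
    by (simp add: pade_def c_def d_def x_def y_def j_def add.commute)
  have p2: "pade r i = (x - 1 gchoose i) * (y - 1 gchoose (r - i))"
    by (simp add: pade_def x_def y_def add.commute)
  have p3: "(if i < r then pade r (Suc i) else 0)
      = (x - 1 gchoose j) * (if i < r then (y - 1 gchoose (r - j)) else 0)"
    by (simp add: pade_def x_def y_def j_def add.commute)
  have "x * y * ((if i < r then pade r (Suc i) else 0) - pade r i)
      = ((x - real j) * c) * ((real r + 1 - real j) * d)
        - (real j * c) * ((y - (real r + 1 - real j)) * d)"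
    unfolding p2 p3 1 2 3 4 by (simp add: algebra_simps)
  also have "\<dots> = c * d * (x * (real r + 1) - real j * (x + y))"
    by (simp add: algebra_simps)
  also have "\<dots> = (real r + 1) * (c * d * (real r + 5/4 - 2 * real j))"
    by (simp add: x_def y_def algebra_simps)
  finally show ?thesis unfolding p1 x_def y_def j_def by simp
qed

text \<open>This ladder relation replaces the hypergeometric integral for the remainder: integrating it
  from 0 gives the order of vanishing and two-sided bounds by induction.\<close>

lemma pade_sin_deriv:
  "(pade_sin (Suc r) has_real_derivative
     - 2 * ((real r + 1)^2 - 1/16) / (real r + 1) * sin \<alpha> * pade_sin r \<alpha>) (at \<alpha>)"
proof -
  define n where "n j = real r + 1/4 - 2 * real j" for j
  define K where "K = (real r + 5/4) * (real r + 3/4)"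
  have K: "K = (real r + 1)^2 - 1/16" by (simp add: K_def power2_eq_square algebra_simps)
  have sc: "2 * sin \<alpha> * sin (n j * \<alpha>) = cos ((n j - 1) * \<alpha>) - cos ((n j + 1) * \<alpha>)" for j
    by (simp add: left_diff_distrib distrib_right cos_add cos_diff)
  define D where "D = (\<Sum>j\<le>Suc r. pade (Suc r) j * (cos ((real (Suc r) + 1/4 - 2 * real j) * \<alpha>)
                        * (real (Suc r) + 1/4 - 2 * real j)))"
  have der: "(pade_sin (Suc r) has_real_derivative D) (at \<alpha>)"
    unfolding pade_sin_def D_def
    by (rule DERIV_cong, (rule derivative_intros | simp)+) (simp add: mult_ac)
  have "(real r + 1) * D = (\<Sum>j\<le>Suc r. ((real r + 1) * (pade (Suc r) j * (real r + 5/4 - 2 * real j)))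
          * cos ((real r + 5/4 - 2 * real j) * \<alpha>))"
    unfolding D_def sum_distrib_left by (intro sum.cong refl) (simp add: algebra_simps)
  also have "\<dots> = ((real r + 1) * (pade (Suc r) 0 * (real r + 5/4))) * cos ((real r + 5/4) * \<alpha>)
      + (\<Sum>i\<le>r. ((real r + 1) * (pade (Suc r) (Suc i) * (real r + 5/4 - 2 * real (Suc i))))
          * cos ((real r + 5/4 - 2 * real (Suc i)) * \<alpha>))"
    by (subst sum.atMost_Suc_shift) simp
  also have "\<dots> = K * pade r 0 * cos ((real r + 5/4) * \<alpha>)
      + (\<Sum>i\<le>r. (K * ((if i < r then pade r (Suc i) else 0) - pade r i))
          * cos ((n i - 1) * \<alpha>))"
    unfolding pade_Suc_0 K_def
    by (intro arg_cong2 [where f = "(+)"] sum.cong refl, subst pade_Suc_Suc)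
       (auto simp: n_def algebra_simps)
  also have "(\<Sum>i\<le>r. (K * ((if i < r then pade r (Suc i) else 0) - pade r i)) * cos ((n i - 1) * \<alpha>))
     = K * ((\<Sum>i\<le>r. (if i < r then pade r (Suc i) else 0) * cos ((n i - 1) * \<alpha>))
          - (\<Sum>i\<le>r. pade r i * cos ((n i - 1) * \<alpha>)))"
    by (simp add: sum_distrib_left sum_subtractf [symmetric] algebra_simps)
  also have "(\<Sum>i\<le>r. (if i < r then pade r (Suc i) else 0) * cos ((n i - 1) * \<alpha>))
     = (\<Sum>i<r. pade r (Suc i) * cos ((n (Suc i) + 1) * \<alpha>))"
    by (rule sum.mono_neutral_cong_right) (auto simp: n_def algebra_simps)
  also have "K * pade r 0 * cos ((real r + 5/4) * \<alpha>) + K * ((\<Sum>i<r. pade r (Suc i) * cos ((n (Suc i) + 1) * \<alpha>))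
          - (\<Sum>i\<le>r. pade r i * cos ((n i - 1) * \<alpha>)))
     = K * ((\<Sum>i\<le>r. pade r i * cos ((n i + 1) * \<alpha>)) - (\<Sum>i\<le>r. pade r i * cos ((n i - 1) * \<alpha>)))"
    by (subst (2) sum.atMost_shift) (simp add: n_def algebra_simps)
  also have "\<dots> = - K * (\<Sum>i\<le>r. pade r i * (2 * sin \<alpha> * sin (n i * \<alpha>)))"
    unfolding sc by (simp add: sum_subtractf right_diff_distrib)
  also have "\<dots> = - 2 * K * sin \<alpha> * pade_sin r \<alpha>"
    unfolding pade_sin_def n_def sum_distrib_left by (intro sum.cong refl) (simp add: algebra_simps)
  finally have "D = - 2 * K / (real r + 1) * sin \<alpha> * pade_sin r \<alpha>"
    by (simp add: field_simps)
  with der show ?thesis by (simp add: K)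
qed

lemma pade_sin_0 [simp]: "pade_sin r 0 = 0"
  by (simp add: pade_sin_def)

lemma pade_sin_minus [simp]: "pade_sin r (- \<alpha>) = - pade_sin r \<alpha>"
  by (simp add: pade_sin_def sum_negf)

lemma pade_const_pos: "pade_const r > 0"
proof (induction r)
  case (Suc r)
  have "(real r + 1)^2 > 1/16"
    by (rule less_le_trans [of _ 1]) (auto simp: power2_eq_square algebra_simps)
  with Suc show ?case by (simp)
qed auto

text \<open>The bounds \<open>\<rho> * x \<le> sin x \<le> x\<close> carry an estimate for
  \<open>r\<close> through the derivative relation to \<open>r + 1\<close>. Each step spends one
  factor \<open>\<rho>\<close> and the base case \<open>sin (\<alpha>/4)\<close> another, hence
  \<open>Suc r\<close>; the minus sign of the relation accumulates to
  \<open>(-1) ^ r\<close>.\<close>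

lemma pade_sin_bounds:
  assumes \<rho>: "0 < \<rho>" "\<rho> \<le> 1" and sin: "\<And>x. 0 \<le> x \<Longrightarrow> x \<le> b \<Longrightarrow> \<rho> * x \<le> sin x"
    and "0 \<le> \<alpha>" "\<alpha> \<le> b"
  shows "\<rho> ^ Suc r * pade_const r * \<alpha> ^ (2 * r + 1) \<le> (-1) ^ r * pade_sin r \<alpha>"
    and "(-1) ^ r * pade_sin r \<alpha> \<le> pade_const r * \<alpha> ^ (2 * r + 1)"
  using assms(4,5)
proof (induction r arbitrary: \<alpha>)
  case 0
  {
    case 1
    have "\<rho> * (\<alpha>/4) \<le> sin (\<alpha>/4)" using 1 by (intro sin) auto
    then show ?case by (simp add: pade_sin_def pade_def)
  next
    case 2
    then show ?case using sin_x_le_x [of "\<alpha>/4"] by (simp add: pade_sin_def pade_def)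
  }
next
  case (Suc r)
  define \<mu> where "\<mu> = 2 * ((real r + 1)^2 - 1/16) / (real r + 1)"
  have "(real r + 1)^2 > 1/16"
    by (rule less_le_trans [of _ 1]) (auto simp: power2_eq_square algebra_simps)
  then have \<mu>: "\<mu> > 0" by (simp add: \<mu>_def)
  define f where "f x = (-1) ^ Suc r * pade_sin (Suc r) x" for x
  have der: "(f has_real_derivative \<mu> * sin x * ((-1) ^ r * pade_sin r x)) (at x)" for x
    unfolding f_def by (rule DERIV_cong [OF DERIV_cmult [OF pade_sin_deriv]]) (simp add: \<mu>_def field_simps)
  \<comment> \<open>The recursion of \<open>pade_const\<close> is made for this: integrating
    \<open>x ^ (2 * r + 2)\<close> divides by \<open>2 * r + 3\<close>.\<close>
  have const: "pade_const (Suc r) * (2 * real r + 3) = \<mu> * pade_const r"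
    by (simp add: \<mu>_def add_nonneg_eq_0_iff divide_simps)
  have pos: "0 \<le> (-1) ^ r * pade_sin r x" if "0 \<le> x" "x \<le> b" for x
    by (rule order_trans [OF _ Suc.IH(1)]) (use that \<rho> pade_const_pos [of r] in auto)
  {
    case 1
    \<comment> \<open>Monotonicity of this difference, which is 0 at 0, stands in for
      integration.\<close>
    define g where "g x = f x - \<rho> ^ Suc (Suc r) * pade_const (Suc r) * x ^ (2 * r + 3)" for x
    have "g 0 \<le> g \<alpha>"
    proof (rule DERIV_nonneg_imp_nondecreasing [OF 1(1)])
      fix x assume x: "0 \<le> x" "x \<le> \<alpha>"
      have "(g has_real_derivative \<mu> * sin x * ((-1) ^ r * pade_sin r x)
         - \<rho> ^ Suc (Suc r) * pade_const (Suc r) * ((2 * real r + 3) * x ^ (2 * r + 2))) (at x)"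
        unfolding g_def
        by (rule DERIV_cong, (rule derivative_intros der | simp)+)
      moreover have "\<rho> ^ Suc (Suc r) * pade_const (Suc r) * ((2 * real r + 3) * x ^ (2 * r + 2))
          = \<mu> * (\<rho> * x) * (\<rho> ^ Suc r * pade_const r * x ^ (2 * r + 1))"
        using arg_cong [OF const, of "\<lambda>y. y * (\<rho> ^ Suc (Suc r) * x ^ (2 * r + 2))"]
        by (simp only: power_Suc power_add mult_ac) (simp add: power2_eq_square mult_ac del: pade_const.simps)
      moreover have "\<dots> \<le> \<mu> * sin x * ((-1) ^ r * pade_sin r x)"
        using \<rho> \<mu> pade_const_pos [of r] x 1
        by (intro mult_mono Suc.IH(1) sin mult_nonneg_nonneg mult_left_mono
            order_trans [OF _ sin [of x]]) auto
      ultimately show "\<exists>y. (g has_real_derivative y) (at x) \<and> y \<ge> 0"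
        by (metis diff_ge_0_iff_ge)
    qed
    then show ?case by (simp add: g_def f_def numeral_3_eq_3)
  next
    case 2
    define g where "g x = pade_const (Suc r) * x ^ (2 * r + 3) - f x" for x
    have "g 0 \<le> g \<alpha>"
    proof (rule DERIV_nonneg_imp_nondecreasing [OF 2(1)])
      fix x assume x: "0 \<le> x" "x \<le> \<alpha>"
      have "(g has_real_derivative pade_const (Suc r) * ((2 * real r + 3) * x ^ (2 * r + 2))
           - \<mu> * sin x * ((-1) ^ r * pade_sin r x)) (at x)"
        unfolding g_def
        by (rule DERIV_cong, (rule derivative_intros der | simp)+)
      moreover have "pade_const (Suc r) * ((2 * real r + 3) * x ^ (2 * r + 2))
          = \<mu> * x * (pade_const r * x ^ (2 * r + 1))"
        using arg_cong [OF const, of "\<lambda>y. y * x ^ (2 * r + 2)"]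
        by (simp only: power_Suc power_add mult_ac) (simp add: power2_eq_square mult_ac del: pade_const.simps)
      moreover have "\<mu> * sin x * ((-1) ^ r * pade_sin r x) \<le> \<mu> * x * (pade_const r * x ^ (2 * r + 1))"
        using \<mu> pade_const_pos [of r] x 2 sin_x_le_x [of x] pos [of x]
        by (intro mult_mono Suc.IH(2) mult_left_mono) auto
      ultimately show "\<exists>y. (g has_real_derivative y) (at x) \<and> y \<ge> 0"
        by (metis diff_ge_0_iff_ge)
    qed
    then show ?case by (simp add: g_def f_def numeral_3_eq_3)
  }
qed

section \<open>Integrality\<close>

lemma convolution_pow8_gbinomial:
  "(\<Sum>k=0..n. (8 ^ k * (a gchoose k)) * (8 ^ (n - k) * (b gchoose (n - k))))
     = 8 ^ n * (a + b gchoose n :: real)"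
proof -
  have "(\<Sum>k=0..n. (8 ^ k * (a gchoose k)) * (8 ^ (n - k) * (b gchoose (n - k))))
      = (\<Sum>k=0..n. 8 ^ n * ((a gchoose k) * (b gchoose (n - k))))"
  proof (intro sum.cong refl)
    fix k assume "k \<in> {0..n}"
    then have "(8::real) ^ n = 8 ^ k * 8 ^ (n - k)" by (simp flip: power_add)
    then show "(8 ^ k * (a gchoose k)) * (8 ^ (n - k) * (b gchoose (n - k)))
       = 8 ^ n * ((a gchoose k) * (b gchoose (n - k)))" by (simp add: mult_ac)
  qed
  then show ?thesis by (simp add: gbinomial_Vandermonde flip: sum_distrib_left)
qed

lemma sum_split_ends:
  fixes f :: "nat \<Rightarrow> real"
  assumes "1 \<le> n"
  shows "(\<Sum>k=0..n. f k) = f 0 + f n + (\<Sum>k=1..<n. f k)"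
proof -
  have "{0..n} = insert 0 (insert n {1..<n})" using assms by auto
  then show ?thesis using assms by simp
qed

text \<open>Write the square root of 1 + 8 X as 1 + 4 Y. Since its square has no terms beyond X, the
  coefficients of Y satisfy \<open>y n = - 2 * (\<Sum>k=1..<n. y k * y (n - k))\<close>; the
  extracted 4 keeps this recursion integral.\<close>

lemma pow8_gbinomial_half:
  assumes "1 \<le> n"
  shows "8 ^ n * (1/2 gchoose n :: real) / 4 \<in> \<int>"
  using assms
proof (induction n rule: less_induct)
  case (less n)
  define y where "y k = 8 ^ k * (1/2 gchoose k :: real) / 4" for k
  show ?case
  proof (cases "n = 1")
    case False
    with less have n: "2 \<le> n" by auto
    have "(1::real) gchoose n = 0"
      using n binomial_gbinomial [of 1 n, where ?'a = real] by (simp add: binomial_eq_0)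
    then have "(\<Sum>k=0..n. (4 * y k) * (4 * y (n - k))) = 0"
      using convolution_pow8_gbinomial [where a = "1/2" and b = "1/2" and n = n] by (simp add: y_def)
    moreover have "(\<Sum>k=1..<n. (4 * y k) * (4 * y (n - k))) = 16 * (\<Sum>k=1..<n. y k * y (n - k))"
      by (simp add: sum_distrib_left mult_ac)
    moreover have "4 * y 0 * (4 * y (n - 0)) + 4 * y n * (4 * y (n - n)) = 8 * y n" by (simp add: y_def)
    ultimately have "y n = - 2 * (\<Sum>k=1..<n. y k * y (n - k))"
      using n sum_split_ends [of n "\<lambda>k. (4 * y k) * (4 * y (n - k))"] by linarith
    moreover have "\<dots> \<in> \<int>"
      by (intro Ints_mult Ints_sum) (auto simp: y_def less.IH)
    ultimately have "y n \<in> \<int>" by (simp only:)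
    then show ?thesis by (simp only: y_def)
  qed auto
qed

text \<open>Now (1 + 2 Y)^2 is the square root of 1 + 8 X, whose coefficients are divisible by 4 by
  the previous lemma; this divisibility compensates the 4 in front of \<open>y n\<close>.\<close>

lemma pow8_gbinomial_quarter:
  assumes "1 \<le> n"
  shows "8 ^ n * (1/4 gchoose n :: real) / 2 \<in> \<int>"
  using assms
proof (induction n rule: less_induct)
  case (less n)
  define y where "y k = 8 ^ k * (1/4 gchoose k :: real) / 2" for k
  show ?case
  proof (cases "n = 1")
    case False
    with less have n: "2 \<le> n" by auto
    have "(\<Sum>k=0..n. (2 * y k) * (2 * y (n - k))) = 8 ^ n * (1/2 gchoose n :: real)"
      using convolution_pow8_gbinomial [where a = "1/4" and b = "1/4" and n = n] by (simp add: y_def)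
    moreover have "(\<Sum>k=1..<n. (2 * y k) * (2 * y (n - k))) = 4 * (\<Sum>k=1..<n. y k * y (n - k))"
      by (simp add: sum_distrib_left mult_ac)
    moreover have "2 * y 0 * (2 * y (n - 0)) + 2 * y n * (2 * y (n - n)) = 4 * y n" by (simp add: y_def)
    ultimately have "y n = 8 ^ n * (1/2 gchoose n) / 4 - (\<Sum>k=1..<n. y k * y (n - k))"
      using n sum_split_ends [of n "\<lambda>k. (2 * y k) * (2 * y (n - k))"] by linarith
    moreover have "\<dots> \<in> \<int>"
      using n by (intro Ints_diff Ints_mult Ints_sum pow8_gbinomial_half) (auto simp: y_def less.IH)
    ultimately have "y n \<in> \<int>" by (simp only:)
    then show ?thesis by (simp only: y_def)
  qed auto
qed

lemma pow8_gbinomial_Ints: "8 ^ m * (real r + 1/4 gchoose m) \<in> \<int>"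
proof (induction r arbitrary: m)
  case 0
  show ?case
  proof (cases "m = 0")
    case False
    then have "2 * (8 ^ m * (1/4 gchoose m :: real) / 2) \<in> \<int>"
      by (intro Ints_mult pow8_gbinomial_quarter) auto
    then show ?thesis by simp
  qed auto
next
  case (Suc r)
  show ?case
  proof (cases m)
    case (Suc k)
    have "8 ^ m * (real (Suc r) + 1/4 gchoose m)
        = 8 * (8 ^ k * (real r + 1/4 gchoose k)) + 8 ^ m * (real r + 1/4 gchoose m)"
      using gbinomial_Suc_Suc [of "real r + 1/4" k] by (simp add: Suc algebra_simps)
    then show ?thesis using Suc.IH by auto
  qed auto
qed

text \<open>These are the Taylor coefficients at 1 of the Pade polynomial. Trinomial revision pulls
  out \<open>real r + 1/4 gchoose m\<close>, and the tops of the rest add up to an integer, so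
  Vandermonde leaves one factor with denominators, cleared by \<open>8 ^ m\<close>.\<close>

lemma sum_pade_choose:
  assumes "m \<le> r"
  shows "(\<Sum>j=m..r. pade r j * real (j choose m))
     = (real r + 1/4 gchoose m) * real (2 * r - m choose (r - m))"
proof -
  have "(\<Sum>j=m..r. pade r j * real (j choose m))
     = (\<Sum>j=m..r. (real r + 1/4 gchoose m)
          * ((real r + 1/4 - real m gchoose (j - m)) * (real r - 1/4 gchoose (r - j))))"
  proof (intro sum.cong refl)
    fix j assume "j \<in> {m..r}"
    then show "pade r j * real (j choose m) = (real r + 1/4 gchoose m)
          * ((real r + 1/4 - real m gchoose (j - m)) * (real r - 1/4 gchoose (r - j)))"
      using gbinomial_trinomial_revision [of m j "real r + 1/4"]
      by (simp add: pade_def binomial_gbinomial mult_ac)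
  qed
  also have "\<dots> = (real r + 1/4 gchoose m) *
       (\<Sum>j=m..r. (real r + 1/4 - real m gchoose (j - m)) * (real r - 1/4 gchoose (r - j)))"
    by (simp add: sum_distrib_left)
  also have "(\<Sum>j=m..r. (real r + 1/4 - real m gchoose (j - m)) * (real r - 1/4 gchoose (r - j)))
    = (\<Sum>i=0..r-m. (real r + 1/4 - real m gchoose i) * (real r - 1/4 gchoose (r - m - i)))"
    using assms by (intro sum.reindex_bij_witness [of _ "\<lambda>i. i + m" "\<lambda>j. j - m"]) auto
  also have "\<dots> = (real (2 * r - m) gchoose (r - m))"
    using assms by (subst gbinomial_Vandermonde) (simp add: of_nat_diff)
  finally show ?thesis by (simp add: binomial_gbinomial)
qed

text \<open>Re-expanding in powers of \<open>w - z\<close> instead of \<open>w\<close> is what keeps the denominators small: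
  in the application \<open>w - z\<close> is itself divisible by 4.\<close>

lemma pade_polynomial_eq:
  fixes z w :: complex
  shows "(\<Sum>j\<le>r. of_real (pade r j) * z ^ (r - j) * w ^ j)
     = (\<Sum>m\<le>r. of_real ((real r + 1/4 gchoose m) * real (2 * r - m choose (r - m)))
          * z ^ (r - m) * (w - z) ^ m)"
proof -
  have "(\<Sum>j\<le>r. of_real (pade r j) * z ^ (r - j) * w ^ j)
      = (\<Sum>j\<le>r. \<Sum>m\<le>j. of_real (pade r j * real (j choose m)) * z ^ (r - m) * (w - z) ^ m)"
  proof (intro sum.cong refl)
    fix j assume "j \<in> {..r}"
    then have j: "z ^ (r - j) * z ^ (j - m) = z ^ (r - m)" if "m \<le> j" for m
      using that by (simp flip: power_add)
    have "w ^ j = ((w - z) + z) ^ j" by simp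
    also have "\<dots> = (\<Sum>m\<le>j. of_nat (j choose m) * (w - z) ^ m * z ^ (j - m))"
      by (rule binomial_ring)
    finally have "of_real (pade r j) * z ^ (r - j) * w ^ j
       = (\<Sum>m\<le>j. of_real (pade r j) * z ^ (r - j) * (of_nat (j choose m) * (w - z) ^ m * z ^ (j - m)))"
      by (simp add: sum_distrib_left)
    also have "\<dots> = (\<Sum>m\<le>j. of_real (pade r j * real (j choose m)) * (z ^ (r - j) * z ^ (j - m)) * (w - z) ^ m)"
      by (intro sum.cong refl) (simp add: mult_ac)
    also have "\<dots> = (\<Sum>m\<le>j. of_real (pade r j * real (j choose m)) * z ^ (r - m) * (w - z) ^ m)"
      by (intro sum.cong refl) (simp only: j atMost_iff)
    finally show "of_real (pade r j) * z ^ (r - j) * w ^ j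
       = (\<Sum>m\<le>j. of_real (pade r j * real (j choose m)) * z ^ (r - m) * (w - z) ^ m)" .
  qed
  also have "\<dots> = (\<Sum>m\<le>r. \<Sum>j=m..r. of_real (pade r j * real (j choose m)) * z ^ (r - m) * (w - z) ^ m)"
    by (subst sum.Sigma, simp, simp, subst sum.Sigma, simp, simp,
        rule sum.reindex_bij_witness [of _ "\<lambda>(m,j). (j,m)" "\<lambda>(j,m). (m,j)"]) auto
  also have "\<dots> = (\<Sum>m\<le>r. of_real (\<Sum>j=m..r. pade r j * real (j choose m)) * z ^ (r - m) * (w - z) ^ m)"
    by (simp add: sum_distrib_right)
  finally show ?thesis by (simp add: sum_pade_choose)
qed

text \<open>If \<open>s * s\<close> is an integer this is the ring Z[s]; it is applied to a square
  root of \<open>- E\<close>.\<close>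

definition int_span :: "complex \<Rightarrow> complex set" where
  "int_span s = {of_int p + of_int q * s | p q. True}"

lemma int_spanI: "of_int p + of_int q * s \<in> int_span s"
  by (auto simp: int_span_def)

lemma int_span_Ints: "x \<in> \<int> \<Longrightarrow> x \<in> int_span s"
  by (elim Ints_cases) (use int_spanI [of _ 0 s] in auto)

lemma int_span_add: "x \<in> int_span s \<Longrightarrow> y \<in> int_span s \<Longrightarrow> x + y \<in> int_span s"
proof -
  assume "x \<in> int_span s" "y \<in> int_span s"
  then obtain p q p' q' where "x = of_int p + of_int q * s" "y = of_int p' + of_int q' * s"
    by (auto simp: int_span_def)
  then have "x + y = of_int (p + p') + of_int (q + q') * s" by (simp add: algebra_simps)
  then show ?thesis by (metis int_spanI)
qed

lemma int_span_mult:
  assumes "s * s = of_int d" "x \<in> int_span s" "y \<in> int_span s"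
  shows "x * y \<in> int_span s"
proof -
  from assms obtain p q p' q' where "x = of_int p + of_int q * s" "y = of_int p' + of_int q' * s"
    by (auto simp: int_span_def)
  then have "x * y = of_int p * of_int p' + of_int q * of_int q' * (s * s)
       + (of_int p * of_int q' + of_int q * of_int p') * s"
    by (simp add: algebra_simps)
  also have "\<dots> = of_int (p * p' + q * q' * d) + of_int (p * q' + q * p') * s"
    by (simp add: assms)
  finally show ?thesis by (metis int_spanI)
qed

lemma int_span_power:
  assumes "s * s = of_int d" "x \<in> int_span s"
  shows "x ^ n \<in> int_span s"
  by (induction n) (use assms int_span_mult int_span_Ints [of 1] in auto)

lemma int_span_sum: "(\<And>i. i \<in> I \<Longrightarrow> f i \<in> int_span s) \<Longrightarrow> sum f I \<in> int_span s"
  by (induction I rule: infinite_finite_induct) (auto intro: int_span_add int_span_Ints)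

text \<open>The difference of the two arguments is \<open>- 4 * F * s\<close>. Its power supplies
  \<open>4 ^ m\<close>, the prefactor \<open>2 ^ r\<close> supplies \<open>2 ^ m\<close>, and the
  resulting \<open>8 ^ m\<close> clears the denominators of the m-th Taylor coefficient.\<close>

lemma pade_polynomial_int_span:
  fixes n F :: int and s :: complex
  assumes "s * s = of_int d"
  shows "2 ^ r * (\<Sum>j\<le>r. of_real (pade r j) * (of_int n + 2 * of_int F * s) ^ (r - j)
           * (of_int n - 2 * of_int F * s) ^ j) \<in> int_span s" (is "2 ^ r * ?S \<in> _")
proof -
  define z where "z = of_int n + 2 * of_int F * s"
  define c where "c m = (8 ^ m * (real r + 1/4 gchoose m)) * real (2 * r - m choose (r - m))" for m
  have z: "z \<in> int_span s" using int_spanI [of n "2 * F" s] by (simp add: z_def)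
  have F: "of_int (- F) * s \<in> int_span s" using int_spanI [of 0 "- F" s] by simp
  have "2 ^ r * ?S = (\<Sum>m\<le>r. 2 ^ (r - m) * of_real (c m) * z ^ (r - m) * (of_int (- F) * s) ^ m)"
    unfolding pade_polynomial_eq sum_distrib_left
  proof (intro sum.cong refl)
    fix m assume "m \<in> {..r}"
    then have "(2::complex) ^ r = 2 ^ (r - m) * 2 ^ m" by (simp flip: power_add)
    moreover have "of_int n - 2 * of_int F * s - (of_int n + 2 * of_int F * s) = 4 * (of_int (- F) * s)"
      by simp
    moreover have "(2::complex) ^ m * 4 ^ m = 8 ^ m" by (simp flip: power_mult_distrib)
    ultimately show "2 ^ r * (of_real ((real r + 1/4 gchoose m) * real (2 * r - m choose (r - m)))
         * (of_int n + 2 * of_int F * s) ^ (r - m) * (of_int n - 2 * of_int F * s - (of_int n + 2 * of_int F * s)) ^ m)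
      = 2 ^ (r - m) * of_real (c m) * z ^ (r - m) * (of_int (- F) * s) ^ m"
      by (simp only: power_mult_distrib z_def c_def of_real_mult of_real_power of_real_numeral)
         (simp add: mult_ac flip: \<open>2 ^ m * 4 ^ m = 8 ^ m\<close>)
  qed
  also have "\<dots> \<in> int_span s"
  proof (rule int_span_sum)
    fix m
    have "c m \<in> \<int>"
      unfolding c_def by (intro Ints_mult pow8_gbinomial_Ints) auto
    then obtain k where "c m = of_int k" by (elim Ints_cases)
    then have "2 ^ (r - m) * of_real (c m) \<in> int_span s"
      by (intro int_span_Ints) simp
    then show "2 ^ (r - m) * of_real (c m) * z ^ (r - m) * (of_int (- F) * s) ^ m \<in> int_span s"
      using int_span_mult [OF assms int_span_mult [OF assms _ int_span_power [OF assms z]]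
          int_span_power [OF assms F]] by blast
  qed
  finally show ?thesis .
qed

section \<open>Excluding a second large point\<close>

lemma central_binomial_Suc:
  "real (r + 1) * real (2 * Suc r choose Suc r) = 2 * (2 * real r + 1) * real (2 * r choose r)"
proof -
  have eq: "real (2 * r choose r) = fact (2 * r) / (fact r * fact r)" for r
    by (simp add: binomial_fact mult_2)
  have "fact (2 * Suc r) = (2 * real r + 2) * ((2 * real r + 1) * fact (2 * r))"
    "fact (Suc r) = (real r + 1) * fact r"
    by (simp_all add: algebra_simps)
  moreover have "real r + 1 \<noteq> 0" by auto
  ultimately show ?thesis
    unfolding eq by (simp only: of_nat_add of_nat_1) (simp add: divide_simps, simp add: algebra_simps)
qed

lemma central_binomial_Suc_le: "real (2 * Suc r choose Suc r) \<le> 4 * real (2 * r choose r)"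
proof -
  have "real (r + 1) * real (2 * Suc r choose Suc r) \<le> real (r + 1) * (4 * real (2 * r choose r))"
    unfolding central_binomial_Suc by (simp add: algebra_simps)
  then show ?thesis by (subst (asm) mult_le_cancel_left_pos) auto
qed

lemma pade_const_Suc_eq:
  "(real r + 1) * (2 * real r + 3) * pade_const (Suc r) = 2 * ((real r + 1)^2 - 1/16) * pade_const r"
proof -
  have "real r + 1 \<noteq> 0" "2 * real r + 3 \<noteq> 0" by (auto simp: add_nonneg_eq_0_iff)
  then show ?thesis by simp
qed

lemma pade_const_Suc_le: "pade_const (Suc r) \<le> pade_const r"
proof -
  have "(real r + 1) * (2 * real r + 3) * pade_const (Suc r)
      \<le> (real r + 1) * (2 * real r + 3) * pade_const r"
    unfolding pade_const_Suc_eq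
    by (intro mult_right_mono less_imp_le [OF pade_const_pos]) (simp add: power2_eq_square algebra_simps)
  moreover have "(real r + 1) * (2 * real r + 3) > 0" by (intro mult_pos_pos) auto
  ultimately show ?thesis by (simp only: mult_le_cancel_left_pos)
qed

text \<open>After the recursions are cleared this is
  \<open>(2 * x + 1) * (2 * x + 3) \<le> 4 * ((x + 1)^2 - 1/16)\<close>. It serves where
  \<open>pade_const (Suc r)\<close> stands on the larger side, so that its decrease has to be paid
  for.\<close>

lemma central_binomial_pade_const:
  "real (2 * Suc r choose Suc r) * pade_const r \<le> 4 * real (2 * r choose r) * pade_const (Suc r)"
proof -
  define C C' e e' x where "C = real (2 * r choose r)" and "C' = real (2 * Suc r choose Suc r)"
    and "e = pade_const r" and "e' = pade_const (Suc r)" and "x = real r"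
  have x: "x \<ge> 0" and Ce: "C * e \<ge> 0"
    using pade_const_pos [of r] by (auto simp: x_def C_def e_def)
  have 1: "(x + 1) * C' = 2 * (2 * x + 1) * C"
    using central_binomial_Suc [of r] by (simp only: C_def C'_def x_def of_nat_add of_nat_1)
  have 2: "(x + 1) * (2 * x + 3) * e' = 2 * ((x + 1)^2 - 1/16) * e"
    unfolding e_def e'_def x_def by (rule pade_const_Suc_eq)
  have "(x + 1) * (2 * x + 3) * (C' * e) = 2 * (2 * x + 1) * (2 * x + 3) * (C * e)"
    using arg_cong [OF 1, of "\<lambda>y. y * (2 * x + 3) * e"] by (simp only: mult_ac)
  also have "\<dots> \<le> 8 * ((x + 1)^2 - 1/16) * (C * e)"
    using x Ce by (intro mult_right_mono) (simp_all add: power2_eq_square algebra_simps)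
  also have "\<dots> = (x + 1) * (2 * x + 3) * (4 * C * e')"
    using arg_cong [OF 2 [symmetric], of "\<lambda>y. y * 4 * C"] by (simp add: mult_ac)
  finally have "(x + 1) * (2 * x + 3) * (C' * e) \<le> (x + 1) * (2 * x + 3) * (4 * C * e')" .
  moreover have "(x + 1) * (2 * x + 3) > 0" using x by (intro mult_pos_pos) auto
  ultimately have "C' * e \<le> 4 * C * e'" by (simp only: mult_le_cancel_left_pos)
  then show ?thesis by (simp only: C_def C'_def e_def e'_def)
qed

section \<open>Linear lower bounds for the sine\<close>

lemma sin_ge_small: "0 \<le> x \<Longrightarrow> x \<le> 1/5 \<Longrightarrow> 99/100 * x \<le> sin (x::real)"
  and sin_ge_half_pi: "0 \<le> x \<Longrightarrow> x \<le> pi/2 \<Longrightarrow> 2/5 * x \<le> sin (x::real)"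
proof -
  have *: "x * (1 - x^2 / 6 - x^3 / 24) \<le> sin x" if "0 \<le> x" for x :: real
  proof -
    have "\<bar>sin x - (\<Sum>m<4. sin_coeff m * x ^ m)\<bar> \<le> inverse (fact 4) * \<bar>x\<bar> ^ 4"
      by (rule Maclaurin_sin_bound)
    moreover have "(\<Sum>m<4. sin_coeff m * x ^ m) = x - x^3 / 6"
      by (simp add: sin_coeff_def eval_nat_numeral) presburger
    moreover have "inverse (fact 4) * \<bar>x\<bar> ^ 4 = x ^ 4 / 24"
      by (simp add: fact_numeral)
    ultimately have "\<bar>sin x - (x - x^3 / 6)\<bar> \<le> x ^ 4 / 24" by (simp only:)
    then have "x - x^3 / 6 - x^4 / 24 \<le> sin x" by linarith
    then show ?thesis
      by (simp add: algebra_simps power2_eq_square power3_eq_cube power4_eq_xxxx abs_le_iff)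
  qed
  {
    assume x: "0 \<le> x" "x \<le> 1/5"
    have "x^2 \<le> (1/5)^2" "x^3 \<le> (1/5)^3" using x by (auto intro!: power_mono)
    then have "99/100 \<le> 1 - x^2 / 6 - x^3 / 24" by (simp add: power_divide)
    then have "x * (99/100) \<le> x * (1 - x^2 / 6 - x^3 / 24)" using x by (intro mult_left_mono)
    also note * [OF x(1)]
    finally show "99/100 * x \<le> sin x" by simp
  next
    assume x: "0 \<le> x" "x \<le> pi/2"
    then have "x \<le> 1.571" using pi_approx by simp
    then have "x^2 \<le> 1.571^2" "x^3 \<le> 1.571^3" using x by (auto intro!: power_mono)
    then have "2/5 \<le> 1 - x^2 / 6 - x^3 / 24" by (simp add: power_divide)
    then have "x * (2/5) \<le> x * (1 - x^2 / 6 - x^3 / 24)" using x by (intro mult_left_mono)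
    also note * [OF x(1)]
    finally show "2/5 * x \<le> sin x" by simp
  }
qed

text \<open>A bootstrap: the crude slope 2/5, valid up to \<open>pi/2\<close>, first brings the
  angle below 1/5, where the slope 99/100 is available.\<close>

lemma sin_abs_small_bound:
  assumes "\<bar>\<alpha>\<bar> \<le> pi/2" "\<bar>sin \<alpha>\<bar> \<le> 8/100"
  shows "\<bar>\<alpha>\<bar> \<le> 1/5" and "99/100 * \<bar>\<alpha>\<bar> \<le> \<bar>sin \<alpha>\<bar>"
proof -
  have eq: "\<bar>sin \<alpha>\<bar> = sin \<bar>\<alpha>\<bar>"
    using assms(1) sin_ge_zero [of "\<bar>\<alpha>\<bar>"] by (cases "\<alpha> \<ge> 0") auto
  have "2/5 * \<bar>\<alpha>\<bar> \<le> sin \<bar>\<alpha>\<bar>" using assms by (intro sin_ge_half_pi) auto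
  then show "\<bar>\<alpha>\<bar> \<le> 1/5" using assms(2) eq by linarith
  then show "99/100 * \<bar>\<alpha>\<bar> \<le> \<bar>sin \<alpha>\<bar>" unfolding eq by (intro sin_ge_small) auto
qed

lemma pade_sin_abs: "\<bar>pade_sin r \<alpha>\<bar> = \<bar>pade_sin r \<bar>\<alpha>\<bar>\<bar>"
  by (cases "\<alpha> \<ge> 0") auto

text \<open>These are the inequalities for the step from \<open>s\<close> to \<open>s + 1\<close> in
  the induction on Pade indices: the first keeps the contribution of the second point small, the
  second excludes a vanishing determinant. Raising \<open>s\<close> by one costs
  \<open>4 * Q ^ 4 * l ^ 6\<close> on the left and gains \<open>u ^ 8\<close> on the right, which
  \<open>T\<close> balances. The numerators 27 and 81 come from cubes and fourth powers of the bound
  3/4 of that induction.\<close>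

lemma pade_gap_powers:
  fixes u Q l \<rho> :: real
  assumes "u > 0" "Q > 0" "l > 0" "0 < \<rho>" "\<rho> \<le> 1"
    and T: "4 * Q ^ 4 * l ^ 6 \<le> \<rho> * u ^ 8"
    and base1: "2 * Q * l ^ 4 \<le> 27 * u ^ 4"
    and base2: "l ^ 2 / 128 < 81 * 5 / (64 * 32) * \<rho> ^ 3"
  shows "real (2 * Suc s choose Suc s) * pade_const s ^ 3 * Q ^ (4 * s + 1) * l ^ (6 * s + 4)
           \<le> 27 / 64 * u ^ (8 * s + 4)"
    and "real (2 * Suc s choose Suc s) * pade_const s ^ 4 * Q ^ (4 * s) * l ^ (6 * s + 2)
           < 81 / 64 * \<rho> ^ (s + 3) * pade_const (Suc s) * u ^ (8 * s)"
proof (induction s)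
  case 0
  { case 1 show ?case using base1 by (simp add: power3_eq_cube) }
  \<comment> \<open>Here \<open>pade_const 1 = 5/32\<close>, and 128 is \<open>4 ^ 4\<close> divided
    by the central binomial 2.\<close>
  { case 2 show ?case using base2 by (simp add: power4_eq_xxxx power2_eq_square power3_eq_cube) }
next
  case (Suc s)
  define C C' e e' e'' where defs: "C = real (2 * Suc s choose Suc s)"
    "C' = real (2 * Suc (Suc s) choose Suc (Suc s))"
    "e = pade_const s" "e' = pade_const (Suc s)" "e'' = pade_const (Suc (Suc s))"
  have pos: "e > 0" "e' > 0" "e'' > 0" "C > 0" "C' > 0"
    using pade_const_pos unfolding defs by (auto simp del: pade_const.simps binomial_Suc_Suc)
  have e: "e' \<le> e" unfolding defs by (rule pade_const_Suc_le)
  have C: "C' \<le> 4 * C" unfolding defs by (rule central_binomial_Suc_le)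
  have Ce: "C' * e' \<le> 4 * C * e''" unfolding defs by (rule central_binomial_pade_const)
  have Q: "Q ^ (4 * Suc s + 1) = Q ^ (4 * s + 1) * Q ^ 4" "Q ^ (4 * Suc s) = Q ^ (4 * s) * Q ^ 4"
    "u ^ (8 * Suc s) = u ^ (8 * s) * u ^ 8" "\<rho> ^ (Suc s + 3) = \<rho> ^ (s + 3) * \<rho>"
    by (simp_all add: power_add numeral_eq_Suc)
  have l: "l ^ (6 * Suc s + 4) = l ^ (6 * s + 4) * l ^ 6" "l ^ (6 * Suc s + 2) = l ^ (6 * s + 2) * l ^ 6"
    using power_add [of l "6 * s + 4" 6] power_add [of l "6 * s + 2" 6] by (simp_all add: ac_simps)
  have T': "4 * Q ^ 4 * l ^ 6 \<le> u ^ 8"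
    using T assms by (smt (verit) mult_left_le_one_le zero_less_power)
  {
    case 1
    have "C' * e' ^ 3 * Q ^ (4 * Suc s + 1) * l ^ (6 * Suc s + 4)
        \<le> (4 * C) * e ^ 3 * Q ^ (4 * Suc s + 1) * l ^ (6 * Suc s + 4)"
      using pos assms C e by (intro mult_right_mono mult_mono power_mono) auto
    also have "\<dots> = (C * e ^ 3 * Q ^ (4 * s + 1) * l ^ (6 * s + 4)) * (4 * Q ^ 4 * l ^ 6)"
      unfolding Q l by (simp only: mult_ac)
    also have "\<dots> \<le> (27 / 64 * u ^ (8 * s + 4)) * u ^ 8"
      by (rule mult_mono [OF Suc.IH(1) [folded defs] T']) (use assms in auto)
    also have "\<dots> = 27 / 64 * u ^ (8 * Suc s + 4)"
      by (simp add: mult.assoc flip: power_add)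
    finally show ?case unfolding defs .
  next
    case 2
    have "e' * (C' * e' ^ 4 * Q ^ (4 * Suc s) * l ^ (6 * Suc s + 2))
        = (C' * e') * e' ^ 4 * Q ^ (4 * Suc s) * l ^ (6 * Suc s + 2)" by (simp add: mult_ac)
    also have "\<dots> \<le> (4 * C * e'') * e ^ 4 * Q ^ (4 * Suc s) * l ^ (6 * Suc s + 2)"
      by (intro mult_right_mono mult_mono [OF Ce power_mono [OF e]]) (use pos assms in auto)
    also have "\<dots> = e'' * (C * e ^ 4 * Q ^ (4 * s) * l ^ (6 * s + 2)) * (4 * Q ^ 4 * l ^ 6)"
      unfolding Q l by (simp only: mult_ac)
    also have "\<dots> < e'' * (81 / 64 * \<rho> ^ (s + 3) * e' * u ^ (8 * s)) * (\<rho> * u ^ 8)"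
      by (rule mult_less_le_imp_less [OF mult_strict_left_mono [OF Suc.IH(2) [folded defs]] T])
         (use assms pos in auto)
    also have "\<dots> = e' * (81 / 64 * \<rho> ^ (Suc s + 3) * e'' * u ^ (8 * Suc s))"
      unfolding Q by (simp only: mult_ac)
    finally show ?case using pos unfolding defs [symmetric] by (simp only: mult_less_cancel_left_pos)
  }
qed

text \<open>The integer in \<open>int\<close> is the determinant of the second point with the \<open>r\<close>-th Pade multiple
  of the first. As long as it is nonzero, \<open>v\<close> is bounded below by a quantity that grows geometrically in
  \<open>r\<close>. If it vanished, the two directions would agree and \<open>\<beta>\<close> would be a Pade remainder, too large
  for a point of the modulus already forced by the previous \<open>r\<close>.\<close>

lemma pade_no_second_point:
  fixes u v \<alpha> \<beta> Q L :: real
  assumes u: "u \<ge> 27/10" and v: "v \<ge> u * cos (\<alpha>/4)" and Q: "Q > 0" and L: "L \<le> 382/100"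
    and \<alpha>: "\<bar>\<alpha>\<bar> \<le> pi/2" "0 < u ^ 4 * \<bar>sin \<alpha>\<bar>" "u ^ 4 * \<bar>sin \<alpha>\<bar> \<le> L"
    and \<beta>: "v > 0" "\<bar>\<beta>\<bar> \<le> pi/2" "v ^ 4 * \<bar>sin \<beta>\<bar> \<le> L"
    and size: "4 * Q ^ 4 * L ^ 6 \<le> (99/100) ^ 7 * u ^ 8"
    and int: "\<And>r. Q ^ r * u ^ (4 * r + 1) * v
                * (cos (\<beta>/4) * pade_sin r \<alpha> - sin (\<beta>/4) * pade_cos r \<alpha>) \<in> \<int>"
    and nz: "sin ((\<alpha> - \<beta>) / 4) \<noteq> 0"
  shows False
proof -
  \<comment> \<open>Passing from sines to angles loses at most the factor \<open>\<rho>\<close>;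
    dividing \<open>L\<close> by it once bounds both \<open>u ^ 4 * a\<close> and
    \<open>v ^ 4 * b\<close> by \<open>l\<close>.\<close>
  define \<rho> l a b where defs: "\<rho> = (99/100 :: real)" "l = L / \<rho>" "a = \<bar>\<alpha>\<bar>" "b = \<bar>\<beta>\<bar>"
  define C where "C r = real (2 * r choose r)" for r
  have u0: "u > 0" using u by simp
  have u4: "u ^ 4 \<ge> (27/10) ^ 4" using u by (intro power_mono) auto
  have u8: "u ^ 8 \<ge> (27/10) ^ 8" using u by (intro power_mono) auto
  have L0: "L > 0" using \<alpha> by linarith
  have l: "0 < l" "l \<le> 386/100" using L0 L by (auto simp: defs)
  have "\<bar>sin \<alpha>\<bar> \<le> L / u ^ 4" using \<alpha>(3) u0 by (simp add: field_simps)
  also have "\<dots> \<le> 382/100 / (27/10) ^ 4" using u4 L L0 u0 by (intro frac_le) auto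
  finally have sa: "\<bar>sin \<alpha>\<bar> \<le> 8/100" by (simp add: power_divide)
  note a = sin_abs_small_bound [OF \<alpha>(1) this, folded defs(3)]
  have cos99: "cos (x/4) \<ge> 99/100" if "\<bar>x\<bar> \<le> 1/5" for x :: real
  proof -
    have "(sin (x/8))^2 \<le> (x/8)^2" using abs_sin_x_le_abs_x [of "x/8"] by (simp only: abs_le_square_iff)
    also have "\<dots> \<le> (1/40)^2" using that by (intro power2_le_iff_abs_le [THEN iffD2]) auto
    finally show ?thesis using cos_double_sin [of "x/8"] by (simp add: power_divide)
  qed
  have "u * (99/100) \<le> u * cos (\<alpha>/4)" using a u0 cos99 [of \<alpha>] by (simp add: defs)
  with v have vu: "v \<ge> 99/100 * u" by simp
  then have "v ^ 4 \<ge> (99/100 * (27/10)) ^ 4" using u by (intro power_mono) auto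
  then have v4: "v ^ 4 \<ge> 51" by (simp add: power_mult_distrib power_divide)
  have "\<bar>sin \<beta>\<bar> \<le> L / v ^ 4" using \<beta> by (simp add: field_simps)
  also have "\<dots> \<le> 382/100 / 51" using v4 L L0 by (intro frac_le) auto
  finally have "\<bar>sin \<beta>\<bar> \<le> 8/100" by simp
  note b = sin_abs_small_bound [OF \<beta>(2) this, folded defs(4)]
  have \<rho>: "0 < \<rho>" "\<rho> \<le> 1" by (auto simp: defs)
  have "a > 0" using \<alpha>(2) by (auto simp: defs)
  have "u ^ 4 * (\<rho> * a) \<le> u ^ 4 * \<bar>sin \<alpha>\<bar>" using a u0 by (intro mult_left_mono) (auto simp: defs)
  with \<alpha>(3) have a_le: "u ^ 4 * a \<le> l" using \<rho> by (simp add: defs field_simps)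
  have "v ^ 4 * (\<rho> * b) \<le> v ^ 4 * \<bar>sin \<beta>\<bar>" using b \<beta> by (intro mult_left_mono) (auto simp: defs)
  with \<beta>(3) have b_le: "v ^ 4 * b \<le> l" using \<rho> by (simp add: defs field_simps)
  have "4 * Q ^ 4 * l ^ 6 = 4 * Q ^ 4 * L ^ 6 / \<rho> ^ 6" by (simp add: defs power_divide)
  also have "\<dots> \<le> \<rho> ^ 7 * u ^ 8 / \<rho> ^ 6"
    using size \<rho> by (intro divide_right_mono) (auto simp: defs)
  finally have T: "4 * Q ^ 4 * l ^ 6 \<le> \<rho> * u ^ 8" using \<rho> by (simp add: eval_nat_numeral)
  have T': "4 * Q ^ 4 * l ^ 6 \<le> u ^ 8"
    by (rule order_trans [OF T]) (use \<rho> u0 in auto)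
  have l4: "l ^ 2 \<le> (386/100) ^ 2" "l ^ 10 \<le> (386/100) ^ 10" using l by (auto intro!: power_mono)
  \<comment> \<open>The hypothesis \<open>size\<close> controls \<open>Q ^ 4\<close>, so fourth
    powers are compared.\<close>
  have base1: "2 * Q * l ^ 4 \<le> 27 * u ^ 4"
  proof (rule power_le_imp_le_base [of _ 3])
    have "(2 * Q * l ^ 4) ^ Suc 3 = 4 * (4 * Q ^ 4 * l ^ 6) * l ^ 10"
      by (simp add: power_mult_distrib flip: power_mult power_add)
    also have "\<dots> \<le> 4 * u ^ 8 * (386/100) ^ 10"
      using T' l4 l Q by (intro mult_mono) auto
    also have "\<dots> \<le> 27 ^ 4 * (27/10) ^ 8 * u ^ 8"
      using u0 by (simp add: power_divide)
    also have "\<dots> \<le> 27 ^ 4 * u ^ 8 * u ^ 8"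
      using u8 u0 by (intro mult_right_mono mult_left_mono) auto
    also have "\<dots> = (27 * u ^ 4) ^ Suc 3" by (simp add: power_mult_distrib flip: power_mult power_add)
    finally show "(2 * Q * l ^ 4) ^ Suc 3 \<le> (27 * u ^ 4) ^ Suc 3" .
  qed (use u0 in auto)
  have base2: "l ^ 2 / 128 < 81 * 5 / (64 * 32) * \<rho> ^ 3"
    using l4(1) by (simp add: defs power_divide)
  note gap = pade_gap_powers [OF u0 Q l(1) \<rho> T base1 base2]
  have e0: "pade_const r > 0" for r by (rule pade_const_pos)
  have C0: "C r > 0" for r by (simp add: C_def)
  define N where "N r = Q ^ r * u ^ (4 * r + 1) * v" for r
  have N0: "N r > 0" for r using Q u0 \<beta> by (simp add: N_def)
  have sinb: "\<bar>sin (\<beta>/4)\<bar> \<le> b / 4" using abs_sin_x_le_abs_x [of "\<beta>/4"] by (simp add: defs)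
  have ps: "\<bar>pade_sin r \<alpha>\<bar> \<le> pade_const r * a ^ (2 * r + 1)"
    "\<rho> ^ Suc r * pade_const r * a ^ (2 * r + 1) \<le> \<bar>pade_sin r \<alpha>\<bar>" for r
  proof -
    have *: "\<And>x. 0 \<le> x \<Longrightarrow> x \<le> 1/5 \<Longrightarrow> \<rho> * x \<le> sin x" using sin_ge_small by (simp add: defs)
    have "0 \<le> a" by (simp add: defs)
    note ** = pade_sin_bounds [OF \<rho> * this a(1), where r = r]
    have "0 \<le> \<rho> ^ Suc r * pade_const r * a ^ (2 * r + 1)"
      using \<rho> e0 [of r] \<open>0 \<le> a\<close> by (intro mult_nonneg_nonneg) auto
    with ** have "\<bar>pade_sin r a\<bar> = (-1) ^ r * pade_sin r a"
      by (cases "even r") auto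
    with ** pade_sin_abs [of r \<alpha>] show "\<bar>pade_sin r \<alpha>\<bar> \<le> pade_const r * a ^ (2 * r + 1)"
      "\<rho> ^ Suc r * pade_const r * a ^ (2 * r + 1) \<le> \<bar>pade_sin r \<alpha>\<bar>"
      by (simp_all add: defs(3))
  qed
  \<comment> \<open>A nonzero integer has modulus at least 1. The term with
    \<open>sin (\<beta>/4)\<close> contributes at most 1/4, so the Pade remainder has to supply
    3/4.\<close>
  have push: "3/4 \<le> N r * (pade_const r * a ^ (2 * r + 1))"
    if nz: "cos (\<beta>/4) * pade_sin r \<alpha> - sin (\<beta>/4) * pade_cos r \<alpha> \<noteq> 0"
      and upper: "N r * C r * b \<le> 1" for r
  proof -
    define d where "d = cos (\<beta>/4) * pade_sin r \<alpha> - sin (\<beta>/4) * pade_cos r \<alpha>"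
    have "N r * d \<in> \<int>" using int [of r] by (simp only: N_def d_def)
    moreover have "N r * d \<noteq> 0" using nz N0 [of r] by (simp add: d_def)
    ultimately have "1 \<le> \<bar>N r * d\<bar>" by (rule Ints_nonzero_abs_ge1)
    also have "\<dots> = N r * \<bar>d\<bar>" using N0 [of r] by (simp add: abs_mult)
    also have "\<bar>d\<bar> \<le> \<bar>cos (\<beta>/4) * pade_sin r \<alpha>\<bar> + \<bar>sin (\<beta>/4) * pade_cos r \<alpha>\<bar>"
      unfolding d_def by (rule abs_triangle_ineq4)
    also have "\<bar>cos (\<beta>/4) * pade_sin r \<alpha>\<bar> \<le> 1 * (pade_const r * a ^ (2 * r + 1))"
      unfolding abs_mult using ps(1) [of r] by (intro mult_mono) auto
    also have "\<bar>sin (\<beta>/4) * pade_cos r \<alpha>\<bar> \<le> b / 4 * C r"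
      unfolding abs_mult C_def using sinb abs_pade_cos_le by (intro mult_mono) (auto simp: defs)
    finally show ?thesis using upper N0 [of r] by (simp add: algebra_simps)
  qed
  have P: "3/4 \<le> N r * (pade_const r * a ^ (2 * r + 1))" for r
  proof (induction r)
    case 0
    show ?case
    proof (rule push)
      \<comment> \<open>For \<open>r = 0\<close> the combination is
        \<open>sin ((\<alpha> - \<beta>) / 4)\<close>.\<close>
      show "cos (\<beta>/4) * pade_sin 0 \<alpha> - sin (\<beta>/4) * pade_cos 0 \<alpha> \<noteq> 0"
        using nz by (simp add: pade_sin_def pade_cos_def pade_def sin_diff diff_divide_distrib mult.commute)
      have "u * (386/100) \<le> (99/100) ^ 3 * (27/10) ^ 2 * u" using u0 by (simp add: power_divide)
      also have "\<dots> \<le> (99/100) ^ 3 * u ^ 2 * u"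
        using u u0 by (intro mult_right_mono mult_left_mono power_mono) auto
      also have "\<dots> = (99/100 * u) ^ 3" by (simp add: power_mult_distrib eval_nat_numeral)
      also have "\<dots> \<le> v ^ 3" using vu u0 by (intro power_mono) auto
      finally have "u * l \<le> v ^ 3" using l u0 by (smt (verit) mult_left_mono)
      moreover have "u * (v ^ 4 * b) \<le> u * l" using b_le u0 by simp
      ultimately have "v ^ 3 * (u * v * b) \<le> v ^ 3 * 1" by (simp add: eval_nat_numeral mult_ac)
      then show "N 0 * C 0 * b \<le> 1" using \<beta> by (subst (asm) mult_le_cancel_left_pos) (auto simp: N_def C_def)
    qed
  next
    case (Suc s)
    define e e' C' where e: "e = pade_const s" and e': "e' = pade_const (Suc s)" and C': "C' = C (Suc s)"
    have pos: "e > 0" "e' > 0" "C' > 0" "u > 0" "v > 0" "a > 0" "l > 0" "Q > 0" "\<rho> > 0" "b \<ge> 0"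
      using e0 C0 \<open>a > 0\<close> \<beta> Q l u0 \<rho> by (auto simp: e e' C' defs(4) simp del: pade_const.simps)
    have IH: "3/4 \<le> Q ^ s * u ^ (4 * s + 1) * v * e * a ^ (2 * s + 1)"
      using Suc.IH by (simp add: N_def e mult_ac)
    have apow: "u ^ (4 * k) * a ^ k \<le> l ^ k" for k
      using power_mono [OF a_le, of k] pos by (simp add: power_mult_distrib power_mult)
    show ?case
    proof (rule push)
      show "cos (\<beta>/4) * pade_sin (Suc s) \<alpha> - sin (\<beta>/4) * pade_cos (Suc s) \<alpha> \<noteq> 0"
      proof
        assume 0: "cos (\<beta>/4) * pade_sin (Suc s) \<alpha> - sin (\<beta>/4) * pade_cos (Suc s) \<alpha> = 0"
        have "\<rho> * (\<rho> ^ Suc (Suc s) * e' * a ^ (2 * Suc s + 1)) \<le> \<bar>cos (\<beta>/4)\<bar> * \<bar>pade_sin (Suc s) \<alpha>\<bar>"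
          using cos99 [of \<beta>] b pos ps(2) [of "Suc s"] unfolding e'
          by (intro mult_mono) (auto simp: defs simp del: pade_const.simps)
        also have "\<dots> = \<bar>sin (\<beta>/4)\<bar> * \<bar>pade_cos (Suc s) \<alpha>\<bar>"
          using 0 by (simp flip: abs_mult)
        also have "\<dots> \<le> b / 4 * C'"
          unfolding C' C_def using pos by (intro mult_mono sinb abs_pade_cos_le) auto
        finally have 1: "4 * \<rho> ^ (s + 3) * e' * a ^ (2 * s + 3) \<le> C' * b"
          by (simp add: eval_nat_numeral algebra_simps)
        \<comment> \<open>The fourth power of \<open>IH\<close> contains the \<open>v ^ 4\<close>
          that eliminates \<open>b\<close> through \<open>b_le\<close>. Then
          \<open>a ^ (2 * s + 3)\<close> is cancelled and the remaining powers of \<open>a\<close>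
          are traded against \<open>u\<close> by \<open>apow\<close>, which leaves the negation of
          \<open>gap(2)\<close>.\<close>
        have "81/64 * \<rho> ^ (s + 3) * e' * a ^ (2 * s + 3)
           = (3/4) ^ 4 * (4 * \<rho> ^ (s + 3) * e' * a ^ (2 * s + 3))" by (simp add: power_divide)
        also have "\<dots> \<le> (Q ^ s * u ^ (4 * s + 1) * v * e * a ^ (2 * s + 1)) ^ 4 * (C' * b)"
          by (rule mult_mono [OF power_mono [OF IH] 1]) (use pos in auto)
        also have "\<dots> = (C' * e ^ 4 * Q ^ (4 * s)) * (u ^ (16 * s + 4) * a ^ (8 * s + 4)) * (v ^ 4 * b)"
          by (simp add: power_mult_distrib power_add mult_ac flip: power_mult)
        also have "\<dots> \<le> (C' * e ^ 4 * Q ^ (4 * s)) * (u ^ (16 * s + 4) * a ^ (8 * s + 4)) * l"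
          using b_le pos by (intro mult_left_mono) auto
        also have "\<dots> = a ^ (2 * s + 3) * ((C' * e ^ 4 * Q ^ (4 * s)) * (u ^ (16 * s + 4) * a ^ (6 * s + 1)) * l)"
        proof -
          have "a ^ (8 * s + 4) = a ^ (2 * s + 3) * a ^ (6 * s + 1)" unfolding power_add [symmetric] by (simp add: add.commute)
          then show ?thesis by (simp only: mult_ac)
        qed
        finally have "81/64 * \<rho> ^ (s + 3) * e' \<le> C' * e ^ 4 * Q ^ (4 * s) * (u ^ (16 * s + 4) * a ^ (6 * s + 1)) * l"
          using pos by (simp add: mult.commute [of _ "a ^ (2 * s + 3)"])
        then have "81/64 * \<rho> ^ (s + 3) * e' * u ^ (8 * s)
          \<le> (C' * e ^ 4 * Q ^ (4 * s) * (u ^ (16 * s + 4) * a ^ (6 * s + 1)) * l) * u ^ (8 * s)"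
          using pos by (intro mult_right_mono) auto
        also have "\<dots> = C' * e ^ 4 * Q ^ (4 * s) * l * (u ^ (4 * (6 * s + 1)) * a ^ (6 * s + 1))"
        proof -
          have "u ^ (4 * (6 * s + 1)) = u ^ (16 * s + 4) * u ^ (8 * s)"
            unfolding power_add [symmetric] by (simp add: add.commute)
          then show ?thesis by (simp only: mult_ac)
        qed
        also have "\<dots> \<le> C' * e ^ 4 * Q ^ (4 * s) * l * l ^ (6 * s + 1)"
          by (rule mult_left_mono [OF apow]) (use pos in auto)
        also have "\<dots> = C' * e ^ 4 * Q ^ (4 * s) * l ^ (6 * s + 2)" by (simp add: power_add power2_eq_square mult_ac)
        finally show False using gap(2) [of s] by (simp only: e e' C' C_def)
      qed
    next
      \<comment> \<open>The cube suffices here: \<open>N (Suc s)\<close> already contains one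
        \<open>v\<close>, and with \<open>v ^ 3\<close> it completes the \<open>v ^ 4\<close> of
        \<open>b_le\<close>.\<close>
      have "27/64 * u ^ (8 * s + 4) * u ^ (4 * s + 5) = (3/4) ^ 3 * u ^ (12 * s + 9)"
        by (simp add: power_divide flip: power_add)
      also have "\<dots> \<le> (Q ^ s * u ^ (4 * s + 1) * v * e * a ^ (2 * s + 1)) ^ 3 * u ^ (12 * s + 9)"
        using IH pos by (intro mult_right_mono power_mono) auto
      also have "\<dots> = e ^ 3 * Q ^ (3 * s) * v ^ 3 * (u ^ (4 * (6 * s + 3)) * a ^ (6 * s + 3))"
      proof -
        have "u ^ (4 * (6 * s + 3)) = u ^ (12 * s + 3) * u ^ (12 * s + 9)"
          unfolding power_add [symmetric] by (simp add: add.commute)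
        moreover have "(Q ^ s * u ^ (4 * s + 1) * v * e * a ^ (2 * s + 1)) ^ 3
            = Q ^ (3 * s) * u ^ (12 * s + 3) * v ^ 3 * e ^ 3 * a ^ (6 * s + 3)"
          by (simp add: power_mult_distrib power_add mult_ac flip: power_mult)
        ultimately show ?thesis by (simp only: mult_ac)
      qed
      also have "\<dots> \<le> e ^ 3 * Q ^ (3 * s) * v ^ 3 * l ^ (6 * s + 3)"
        by (rule mult_left_mono [OF apow]) (use pos in auto)
      finally have 1: "27/64 * u ^ (8 * s + 4) * u ^ (4 * s + 5) \<le> e ^ 3 * Q ^ (3 * s) * v ^ 3 * l ^ (6 * s + 3)" .
      have "(C' * e ^ 3 * Q ^ (4 * s + 1) * l ^ (6 * s + 4)) * u ^ (4 * s + 5)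
          \<le> 27/64 * u ^ (8 * s + 4) * u ^ (4 * s + 5)"
        using gap(1) [of s] pos unfolding C' C_def e by (intro mult_right_mono) auto
      also note 1
      finally have "(e ^ 3 * Q ^ (3 * s) * l ^ (6 * s + 3)) * (C' * Q ^ Suc s * l * u ^ (4 * s + 5))
           \<le> (e ^ 3 * Q ^ (3 * s) * l ^ (6 * s + 3)) * v ^ 3"
        by (simp add: mult_ac eval_nat_numeral power_add)
      then have 2: "C' * Q ^ Suc s * l * u ^ (4 * s + 5) \<le> v ^ 3"
        using pos by (subst (asm) mult_le_cancel_left_pos) auto
      have "v ^ 3 * (N (Suc s) * C (Suc s) * b) = C' * Q ^ Suc s * (v ^ 4 * b) * u ^ (4 * s + 5)"
        by (simp add: N_def C' mult_ac eval_nat_numeral)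
      also have "\<dots> \<le> C' * Q ^ Suc s * l * u ^ (4 * s + 5)"
        using b_le pos by (intro mult_right_mono mult_left_mono) auto
      also note 2
      finally show "N (Suc s) * C (Suc s) * b \<le> 1" using pos by simp
    qed
  qed
  \<comment> \<open>The spare factor 1/2 turns \<open>P\<close> into a lower bound for
    \<open>v * l\<close> that doubles with each \<open>r\<close>, which no fixed \<open>v\<close>
    can satisfy.\<close>
  have Ql: "Q * l ^ 2 \<le> u ^ 4 / 2"
  proof (rule power_le_imp_le_base [of _ 3])
    have "(Q * l ^ 2) ^ Suc 3 = (4 * Q ^ 4 * l ^ 6) * l ^ 2 / 4"
      by (simp add: power_mult_distrib flip: power_mult power_add)
    also have "\<dots> \<le> u ^ 8 * (386/100) ^ 2 / 4"
      using T' l4 l Q by (intro divide_right_mono mult_mono) auto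
    also have "\<dots> \<le> (27/10) ^ 8 / 16 * u ^ 8"
      using u0 by (simp add: power_divide)
    also have "\<dots> \<le> u ^ 8 / 16 * u ^ 8"
      using u8 u0 by (intro mult_right_mono divide_right_mono) auto
    also have "\<dots> = (u ^ 4 / 2) ^ Suc 3" by (simp add: power_divide flip: power_mult power_add)
    finally show "(Q * l ^ 2) ^ Suc 3 \<le> (u ^ 4 / 2) ^ Suc 3" .
  qed (use u0 in auto)
  have e_le: "pade_const r \<le> 1/4" for r
  proof (induction r)
    case (Suc r)
    then show ?case using pade_const_Suc_le [of r] by linarith
  qed simp
  have bounded: "3 * u ^ 3 * 2 ^ r \<le> v * l" for r
  proof -
    have "3/4 \<le> N r * (pade_const r * a ^ (2 * r + 1))" by (rule P)
    also have "\<dots> \<le> N r * (1/4 * a ^ (2 * r + 1))"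
      using e_le [of r] N0 [of r] \<open>a > 0\<close> by (intro mult_left_mono mult_right_mono) auto
    finally have "3/4 * u ^ (4 * r + 3) \<le> N r * (1/4 * a ^ (2 * r + 1)) * u ^ (4 * r + 3)"
      using u0 by (intro mult_right_mono) auto
    also have "\<dots> = Q ^ r * v / 4 * (u ^ 4 * a) ^ (2 * r + 1)"
    proof -
      have "(u ^ 4) ^ (2 * r + 1) = u ^ (4 * r + 1) * u ^ (4 * r + 3)"
        unfolding power_add [symmetric] power_mult [symmetric] by (simp add: add.commute)
      then show ?thesis by (simp add: N_def power_mult_distrib)
    qed
    also have "\<dots> \<le> Q ^ r * v / 4 * l ^ (2 * r + 1)"
      using a_le Q \<beta> u0 \<open>a > 0\<close> by (intro mult_left_mono power_mono) auto
    also have "\<dots> = v * l / 4 * (Q * l ^ 2) ^ r"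
      by (simp add: power_mult_distrib mult_ac flip: power_mult)
    also have "\<dots> \<le> v * l / 4 * (u ^ 4 / 2) ^ r"
      using Ql Q l \<beta> u0 by (intro mult_left_mono power_mono) auto
    also have "\<dots> = v * l / 4 * (u ^ 4) ^ r / 2 ^ r" by (simp add: power_divide)
    also have "u ^ (4 * r + 3) = u ^ 3 * (u ^ 4) ^ r"
      unfolding power_mult [symmetric] power_add [symmetric] by (simp add: add.commute)
    finally have *: "3/4 * (u ^ 3 * (u ^ 4) ^ r) \<le> v * l / 4 * (u ^ 4) ^ r / 2 ^ r" .
    define w where "w = (u ^ 4) ^ r"
    have "w > 0" using u0 by (simp add: w_def)
    from * have "(3 * u ^ 3 * 2 ^ r) * w \<le> (v * l) * w"
      unfolding w_def [symmetric] by (simp add: field_simps)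
    then show ?thesis using \<open>w > 0\<close> by (subst (asm) mult_le_cancel_right_pos)
  qed
  moreover obtain r where "v * l < 2 ^ r"
    using real_arch_pow [of 2 "v * l"] by auto
  moreover have "1 * 2 ^ r \<le> 3 * u ^ 3 * 2 ^ r"
    using power_mono [of "27/10" u 3] u by (intro mult_right_mono) (simp_all add: power_divide)
  ultimately show False
    using bounded [of r] by linarith
qed

section \<open>Small points of a class\<close>

text \<open>The numbers come from maximising \<open>\<bar>y\<bar>\<close> and \<open>x\<^sup>3 \<bar>y\<bar>\<close> over the part of
  \<open>4 x \<bar>y\<bar> (x\<^sup>2 - y\<^sup>2) \<le> 12 / (pi * t^4)\<close> inside the sector of opening \<open>pi/4\<close>.\<close>

definition near_axis :: "real \<Rightarrow> real \<Rightarrow> real \<Rightarrow> bool" where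
  "near_axis t x y \<longleftrightarrow> 0 < x \<and> t * \<bar>y\<bar> \<le> 5368/10000 \<and> t ^ 4 * (x ^ 3 * \<bar>y\<bar>) \<le> 116/100"

lemma near_axis_polar:
  assumes t: "t \<ge> 1" and u: "u > 0" and \<alpha>: "\<bar>\<alpha>\<bar> \<le> pi/2" "u ^ 4 * \<bar>sin \<alpha>\<bar> \<le> 12 / (pi * t ^ 4)"
  shows "near_axis t (u * cos (\<alpha>/4)) (u * sin (\<alpha>/4))"
proof -
  define x y where "x = u * cos (\<alpha>/4)" and "y = \<bar>u * sin (\<alpha>/4)\<bar>"
  have x: "x > 0" 
  proof -
    have "- (pi/2) < \<alpha>/4" "\<alpha>/4 < pi/2" using \<alpha>(1) pi_gt_zero by linarith+
    then show ?thesis unfolding x_def using u by (intro mult_pos_pos cos_gt_zero_pi)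
  qed
  have y: "y \<ge> 0" by (simp add: y_def)
  have "\<bar>sin (\<alpha>/2)\<bar> \<le> cos (\<alpha>/2)"
  proof -
    have "cos (pi/4) \<le> cos \<bar>\<alpha>/2\<bar>" using \<alpha>(1) by (intro cos_monotone_0_pi_le) auto
    moreover have "sin \<bar>\<alpha>/2\<bar> \<le> sin (pi/4)" using \<alpha>(1) by (intro sin_monotone_2pi_le) auto
    moreover have "sin \<bar>\<alpha>/2\<bar> = \<bar>sin (\<alpha>/2)\<bar>"
      using \<alpha>(1) sin_ge_zero [of "\<bar>\<alpha>/2\<bar>"] by (cases "\<alpha> \<ge> 0") auto
    moreover have "cos \<bar>\<alpha>/2\<bar> = cos (\<alpha>/2)" by (rule cos_abs_real)
    ultimately show ?thesis using sin_45 cos_45 by linarith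
  qed
  then have "u\<^sup>2 * \<bar>sin (\<alpha>/2)\<bar> \<le> u\<^sup>2 * cos (\<alpha>/2)" by (intro mult_left_mono) auto
  moreover have "u\<^sup>2 * \<bar>sin (\<alpha>/2)\<bar> = 2 * x * y"
    using sin_double [of "\<alpha>/4"] u x by (simp add: x_def y_def abs_mult power2_eq_square zero_less_mult_iff)
  moreover have "u\<^sup>2 * cos (\<alpha>/2) = x\<^sup>2 - y\<^sup>2"
  proof -
    have "cos (\<alpha>/2) = (cos (\<alpha>/4))\<^sup>2 - (sin (\<alpha>/4))\<^sup>2" using cos_double [of "\<alpha>/4"] by simp
    then show ?thesis by (simp only: x_def y_def power2_abs power_mult_distrib right_diff_distrib)
  qed
  ultimately have xy: "2 * x * y \<le> x\<^sup>2 - y\<^sup>2" by simp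
  have "0 \<le> 2 * x * y" using x y by simp
  then have "y\<^sup>2 \<le> x\<^sup>2" using xy by linarith
  then have "y \<le> x" by (rule power2_le_imp_le) (use x in simp)
  \<comment> \<open>Completing the square in \<open>xy\<close> gives
    \<open>x \<ge> (1 + sqrt 2) * y\<close>, the ray at angle \<open>pi/8\<close>, without
    evaluating \<open>tan (pi/8)\<close>.\<close>
  have "(14142/10000 * y)\<^sup>2 \<le> 2 * y\<^sup>2" by (simp add: power_mult_distrib power_divide)
  also have "\<dots> \<le> (x - y)\<^sup>2" using xy by (simp add: power2_eq_square algebra_simps)
  finally have "14142/10000 * y \<le> x - y" by (rule power2_le_imp_le) (use \<open>y \<le> x\<close> in simp)
  then have yx: "24142/10000 * y \<le> x" by simp
  have "u ^ 4 * \<bar>sin \<alpha>\<bar> = 4 * x * y * (x\<^sup>2 - y\<^sup>2)"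
  proof -
    have "sin \<alpha> = 2 * sin (\<alpha>/2) * cos (\<alpha>/2)" using sin_double [of "\<alpha>/2"] by simp
    moreover have "cos (\<alpha>/2) \<ge> 0" using \<open>\<bar>sin (\<alpha>/2)\<bar> \<le> cos (\<alpha>/2)\<close> by linarith
    ultimately have "u ^ 4 * \<bar>sin \<alpha>\<bar> = 2 * (u\<^sup>2 * \<bar>sin (\<alpha>/2)\<bar>) * (u\<^sup>2 * cos (\<alpha>/2))"
      by (simp add: abs_mult power4_eq_xxxx power2_eq_square)
    then show ?thesis
      unfolding \<open>u\<^sup>2 * \<bar>sin (\<alpha>/2)\<bar> = 2 * x * y\<close> \<open>u\<^sup>2 * cos (\<alpha>/2) = x\<^sup>2 - y\<^sup>2\<close> by simp
  qed
  \<comment> \<open>On that ray the ratio of \<open>x^2 - y^2\<close> to \<open>x^2\<close> is 1 -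
    1/(1 + sqrt 2)^2, just above 82842/100000.\<close>
  also have "\<dots> \<ge> 4 * x * y * (82842/100000 * x\<^sup>2)"
  proof (intro mult_left_mono)
    have "(24142/10000 * y)\<^sup>2 \<le> x\<^sup>2" using yx y by (intro power_mono) auto
    then have "582836164/100000000 * y\<^sup>2 \<le> x\<^sup>2" by (simp add: power_mult_distrib power_divide)
    then show "82842/100000 * x\<^sup>2 \<le> x\<^sup>2 - y\<^sup>2" using zero_le_power2 [of x] by linarith
  qed (use x y in auto)
  finally have "331368/100000 * (x ^ 3 * y) \<le> u ^ 4 * \<bar>sin \<alpha>\<bar>"
    by (simp add: power2_eq_square power3_eq_cube)
  also have "\<dots> \<le> 12 / (pi * t ^ 4)" by (rule \<alpha>)
  finally have "t ^ 4 * (331368/100000 * (x ^ 3 * y)) \<le> t ^ 4 * (12 / (pi * t ^ 4))"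
    using t by (intro mult_left_mono) auto
  also have "\<dots> = 12 / pi" using t by simp
  also have "\<dots> \<le> 12 / (314/100)" using pi_approx by (intro divide_left_mono) auto
  finally have "331368/100000 * (t ^ 4 * (x ^ 3 * y)) \<le> 12 / (314/100)"
    by (simp only: mult.left_commute)
  moreover have "z \<le> 11533/10000" if "331368/100000 * z \<le> 12 / (314/100)" for z :: real
    using that by simp
  ultimately have *: "t ^ 4 * (x ^ 3 * y) \<le> 11533/10000" by blast
  \<comment> \<open>Exchanging three of the four factors \<open>y\<close> for \<open>x\<close>
    reduces the bound on \<open>y\<close> to the one on \<open>x ^ 3 * y\<close>.\<close>
  have "(t * y) ^ Suc 3 * (24142/10000) ^ 3 = t ^ 4 * ((24142/10000 * y) ^ 3 * y)"
    by (simp add: power_mult_distrib eval_nat_numeral)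
  also have "\<dots> \<le> t ^ 4 * (x ^ 3 * y)"
    using yx y t by (intro mult_left_mono mult_right_mono power_mono) auto
  also have "\<dots> \<le> (5368/10000) ^ Suc 3 * (24142/10000) ^ 3" using * by (simp add: power_divide)
  finally have "(t * y) ^ Suc 3 \<le> (5368/10000) ^ Suc 3"
    by (subst (asm) mult_le_cancel_right_pos) auto
  then have "t * y \<le> 5368/10000" by (rule power_le_imp_le_base) simp
  with x * show ?thesis by (simp add: near_axis_def x_def y_def)
qed

section \<open>Gap principles near one axis\<close>

text \<open>For equal signs the determinant is a difference of nonnegative products, hence bounded
  by the larger one instead of their sum. The factor 1862/1000 lies just below 1/0.5368.\<close>

lemma near_axis_same_sign:
  assumes t: "t > 0" and "near_axis t x1 y1" "near_axis t x2 y2" "1 \<le> \<bar>x1 * y2 - x2 * y1\<bar>"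
    and "x1 \<le> M" "x2 \<le> M" and "0 \<le> y1 * y2"
  shows "1862/1000 * t \<le> M"
proof -
  have pos: "x1 > 0" "x2 > 0" "t * \<bar>y1\<bar> \<le> 5368/10000" "t * \<bar>y2\<bar> \<le> 5368/10000"
    using assms by (auto simp: near_axis_def)
  have "\<bar>x1 * y2 - x2 * y1\<bar> = \<bar>x1 * \<bar>y2\<bar> - x2 * \<bar>y1\<bar>\<bar>"
    using \<open>0 \<le> y1 * y2\<close> pos by (auto simp: zero_le_mult_iff)
  also have "\<dots> \<le> max (x1 * \<bar>y2\<bar>) (x2 * \<bar>y1\<bar>)"
  proof -
    have "0 \<le> x1 * \<bar>y2\<bar>" "0 \<le> x2 * \<bar>y1\<bar>" using pos by auto
    then show ?thesis by linarith
  qed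
  finally have "t * 1 \<le> t * max (x1 * \<bar>y2\<bar>) (x2 * \<bar>y1\<bar>)"
    using assms by (intro mult_left_mono) auto
  also have "\<dots> = max (x1 * (t * \<bar>y2\<bar>)) (x2 * (t * \<bar>y1\<bar>))"
    using t by (simp add: max_mult_distrib_left mult_ac)
  also have "\<dots> \<le> M * (5368/10000)"
    using assms pos by (intro max.boundedI mult_mono) auto
  finally show ?thesis using t by simp
qed

text \<open>Among three reals two have a nonnegative product, so some pair falls under
  \<open>near_axis_same_sign\<close>.\<close>

lemma near_axis_three:
  assumes "t > 0" "near_axis t x1 y1" "near_axis t x2 y2" "near_axis t x3 y3"
    and "1 \<le> \<bar>x1 * y2 - x2 * y1\<bar>" "1 \<le> \<bar>x1 * y3 - x3 * y1\<bar>" "1 \<le> \<bar>x2 * y3 - x3 * y2\<bar>"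
    and "x1 \<le> x3" "x2 \<le> x3"
  shows "1862/1000 * t \<le> x3"
proof -
  have "0 \<le> y1 * y2 \<or> 0 \<le> y1 * y3 \<or> 0 \<le> y2 * y3"
    by (auto simp: zero_le_mult_iff)
  then consider "0 \<le> y1 * y2" | "0 \<le> y1 * y3" | "0 \<le> y2 * y3"
    by blast
  then show ?thesis
  proof cases
    case 1
    then show ?thesis using near_axis_same_sign [of t x1 y1 x2 y2 x3] assms by blast
  next
    case 2
    then show ?thesis using near_axis_same_sign [of t x1 y1 x3 y3 x3] assms by blast
  next
    case 3
    then show ?thesis using near_axis_same_sign [of t x2 y2 x3 y3 x3] assms by blast
  qed
qed

text \<open>Multiplied by \<open>t ^ 4 * x1 ^ 3\<close>, each of the two products in the determinant
  is at most \<open>116/100 * x2\<close>; for the first, \<open>x1 \<le> x2\<close> is used. This is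
  the cubing step.\<close>

lemma near_axis_gap:
  assumes t: "t > 0" and "near_axis t x1 y1" "near_axis t x2 y2" "1 \<le> \<bar>x1 * y2 - x2 * y1\<bar>"
    and x: "x1 \<le> x2"
  shows "t ^ 4 * x1 ^ 3 \<le> 232/100 * x2"
proof -
  have pos: "x1 > 0" "x2 > 0" "t ^ 4 * (x1 ^ 3 * \<bar>y1\<bar>) \<le> 116/100" "t ^ 4 * (x2 ^ 3 * \<bar>y2\<bar>) \<le> 116/100"
    using assms by (auto simp: near_axis_def)
  have "1 \<le> x1 * \<bar>y2\<bar> + x2 * \<bar>y1\<bar>"
    using assms(4) pos abs_triangle_ineq4 [of "x1 * y2" "x2 * y1"] by (simp add: abs_mult)
  then have "t ^ 4 * x1 ^ 3 * 1 \<le> t ^ 4 * x1 ^ 3 * (x1 * \<bar>y2\<bar> + x2 * \<bar>y1\<bar>)"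
    using t pos by (intro mult_left_mono) auto
  also have "\<dots> = t ^ 4 * (x1 ^ 3 * \<bar>y2\<bar>) * x1 + t ^ 4 * (x1 ^ 3 * \<bar>y1\<bar>) * x2"
    by (simp add: algebra_simps)
  also have "t ^ 4 * (x1 ^ 3 * \<bar>y2\<bar>) * x1 \<le> t ^ 4 * (x2 ^ 3 * \<bar>y2\<bar>) * x2"
    using t pos x by (intro mult_mono mult_right_mono mult_left_mono power_mono) auto
  also have "\<dots> \<le> 116/100 * x2" using pos by (intro mult_right_mono) auto
  also have "t ^ 4 * (x1 ^ 3 * \<bar>y1\<bar>) * x2 \<le> 116/100 * x2" using pos by (intro mult_right_mono) auto
  finally show ?thesis by simp
qed

text \<open>With \<open>t ^ 4 \<ge> 2\<close> two points already suffice, whatever their signs: if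
  \<open>x2\<close> were small, both bounds of \<open>near_axis\<close> together would leave the
  determinant below 1.\<close>

lemma near_axis_two:
  assumes t: "t \<ge> 1" "t ^ 4 \<ge> 2" and "near_axis t x1 y1" "near_axis t x2 y2" "1 \<le> \<bar>x1 * y2 - x2 * y1\<bar>"
    and x: "x1 \<le> x2"
  shows "3/2 * t \<le> x2"
proof (rule ccontr)
  assume "\<not> 3/2 * t \<le> x2"
  define b where "b = x2 / t"
  have pos: "x1 > 0" "x2 > 0" "t ^ 4 * (x2 ^ 3 * \<bar>y2\<bar>) \<le> 116/100"
    "t * \<bar>y1\<bar> \<le> 5368/10000" "t * \<bar>y2\<bar> \<le> 5368/10000"
    using assms by (auto simp: near_axis_def)
  have x2: "x2 = b * t" and b: "0 < b" "b < 3/2"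
    using t pos \<open>\<not> 3/2 * t \<le> x2\<close> by (auto simp: b_def field_simps)
  have "1 \<le> x1 * \<bar>y2\<bar> + x2 * \<bar>y1\<bar>"
    using assms(5) pos abs_triangle_ineq4 [of "x1 * y2" "x2 * y1"] by (simp add: abs_mult)
  also have "x1 * \<bar>y2\<bar> \<le> x2 * \<bar>y2\<bar>" using x by (intro mult_right_mono) auto
  also have "x2 * \<bar>y1\<bar> = b * (t * \<bar>y1\<bar>)" by (simp add: x2)
  also have "\<dots> \<le> b * (5368/10000)" using pos b by (intro mult_left_mono) auto
  finally have 1: "1 \<le> x2 * \<bar>y2\<bar> + b * (5368/10000)" by simp
  have "x2 * \<bar>y2\<bar> = b * (t * \<bar>y2\<bar>)" by (simp add: x2)
  also have "\<dots> \<le> b * (5368/10000)" using pos b by (intro mult_left_mono) auto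
  finally have b1: "9314/10000 \<le> b" using 1 by simp
  have "t\<^sup>2 \<ge> 1414/1000"
    by (rule power2_le_imp_le) (use t in \<open>auto simp: power_divide\<close>)
  then have "t\<^sup>2 * t ^ 4 \<ge> 1414/1000 * 2" using t by (intro mult_mono) auto
  then have "2828/1000 * (b\<^sup>2 * (x2 * \<bar>y2\<bar>)) \<le> t ^ 6 * (b\<^sup>2 * (x2 * \<bar>y2\<bar>))"
    using pos by (intro mult_right_mono) (auto simp flip: power_add)
  also have "\<dots> = t ^ 4 * (x2 ^ 3 * \<bar>y2\<bar>)"
    by (simp add: x2 power_mult_distrib eval_nat_numeral)
  also have "\<dots> \<le> 116/100" by (rule pos)
  finally have "b\<^sup>2 * (x2 * \<bar>y2\<bar>) \<le> 4102/10000" by linarith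
  moreover have "b\<^sup>2 * 1 \<le> b\<^sup>2 * (x2 * \<bar>y2\<bar> + b * (5368/10000))"
    using 1 by (intro mult_left_mono) auto
  ultimately have "b\<^sup>2 \<le> 4102/10000 + 5368/10000 * b ^ 3"
    by (simp add: algebra_simps power2_eq_square power3_eq_cube)
  \<comment> \<open>A certificate that the cubic inequality for \<open>b\<close> fails between
    0.9314 and 3/2. The third factor is chosen so that the coefficient of \<open>b^2\<close> is
    close to 1/0.5368, the ratio occurring in that inequality.\<close>
  moreover have "(b - 9314/10000) * (3/2 - b) * (b + 568/1000) \<ge> 0"
    using b b1 by (intro mult_nonneg_nonneg) auto
  moreover have "(b - 9314/10000) * (3/2 - b) * (b + 568/1000)
      = - (b ^ 3) + 18634/10000 * b\<^sup>2 - 160648/10000000 * b - 7935528/10000000"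
    by (simp add: field_simps power2_eq_square power3_eq_cube)
  moreover have "b\<^sup>2 \<le> 3/2 * b" unfolding power2_eq_square using b by (intro mult_right_mono) auto
  ultimately show False using b b1 by linarith
qed

lemma near_axis_three':
  assumes t: "t \<ge> 1" "t ^ 4 \<ge> 2" and n: "near_axis t x1 y1" "near_axis t x2 y2" "near_axis t x3 y3"
    and d: "1 \<le> \<bar>x1 * y2 - x2 * y1\<bar>" "1 \<le> \<bar>x2 * y3 - x3 * y2\<bar>"
    and x: "x1 \<le> x2" "x2 \<le> x3"
  shows "145/100 * t ^ 7 \<le> x3"
proof -
  have "3/2 * t \<le> x2" using near_axis_two t n d x by blast
  then have "t ^ 4 * (3/2 * t) ^ 3 \<le> t ^ 4 * x2 ^ 3"
    using t by (intro mult_left_mono power_mono) auto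
  also have "\<dots> \<le> 232/100 * x3" using near_axis_gap [of t x2 y2 x3 y3] t n d x by auto
  finally have "27/8 * t ^ 7 \<le> 232/100 * x3"
    by (simp add: power_mult_distrib power_divide mult_ac flip: power_add)
  moreover have "t ^ 7 \<ge> 0" using t by simp
  ultimately show ?thesis by linarith
qed

text \<open>Without \<open>t ^ 4 \<ge> 2\<close>, one cubing of \<open>near_axis_three\<close>
  reaches only the exponent 7. For \<open>t ^ 4 < 2\<close> the missing factor is gained by feeding
  this weaker bound for \<open>x4\<close> back into the determinant of the last two points.\<close>

lemma near_axis_four:
  assumes t: "t \<ge> 1" and n: "near_axis t x1 y1" "near_axis t x2 y2" "near_axis t x3 y3" "near_axis t x4 y4"
    and d: "1 \<le> \<bar>x1 * y2 - x2 * y1\<bar>" "1 \<le> \<bar>x1 * y3 - x3 * y1\<bar>" "1 \<le> \<bar>x2 * y3 - x3 * y2\<bar>"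
      "1 \<le> \<bar>x3 * y4 - x4 * y3\<bar>"
    and x: "x1 \<le> x2" "x2 \<le> x3" "x3 \<le> x4"
  shows "27/10 * t ^ 11 \<le> x4"
proof (cases "t ^ 4 \<ge> 2")
  case True
  have "145/100 * t ^ 7 \<le> x3" using near_axis_three' True t n d x by blast
  then have "t ^ 4 * (145/100 * t ^ 7) ^ 3 \<le> t ^ 4 * x3 ^ 3"
    using t by (intro mult_left_mono power_mono) auto
  also have "\<dots> \<le> 232/100 * x4" using near_axis_gap [of t x3 y3 x4 y4] t n d x by auto
  finally have "t ^ 4 * (145/100 * t ^ 7) ^ 3 \<le> 232/100 * x4" .
  then have "(145/100) ^ 3 * t ^ 25 \<le> 232/100 * x4"
  proof -
    have "t ^ 4 * (145/100 * t ^ 7) ^ 3 = (145/100) ^ 3 * t ^ 25"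
      by (simp only: power_mult_distrib power_mult [symmetric] mult.left_commute power_add [symmetric]) simp
    then show ?thesis using \<open>t ^ 4 * (145/100 * t ^ 7) ^ 3 \<le> 232/100 * x4\<close> by simp
  qed
  moreover have "(145/100) ^ 3 * (8 * t ^ 11) \<le> (145/100) ^ 3 * t ^ 25"
  proof (intro mult_left_mono)
    have "2 ^ 3 * t ^ 11 \<le> (t ^ 4) ^ 3 * t ^ 13" using True t
      by (intro mult_mono power_mono power_increasing) auto
    then show "8 * t ^ 11 \<le> t ^ 25" by (simp flip: power_add power_mult)
  qed auto
  moreover have "t ^ 11 \<ge> 0" using t by simp
  moreover have "(145/100) ^ 3 = (3048625/1000000 :: real)" by (simp add: power_divide)
  ultimately show ?thesis by (simp only:)
next
  case False
  define R where "R = t ^ 4"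
  have R: "1 \<le> R" "R < 2" using False t by (auto simp: R_def)
  show ?thesis
  proof (rule ccontr)
    assume "\<not> 27/10 * t ^ 11 \<le> x4"
    then have x4: "x4 < 27/10 * t ^ 11" by simp
    have pos: "x3 > 0" "x4 > 0" "t ^ 4 * (x3 ^ 3 * \<bar>y3\<bar>) \<le> 116/100" "t ^ 4 * (x4 ^ 3 * \<bar>y4\<bar>) \<le> 116/100"
      using n by (auto simp: near_axis_def)
    have x3: "1862/1000 * t \<le> x3" using near_axis_three [of t x1 y1 x2 y2 x3 y3] t n d x by auto
    have x33: "645/100 * t ^ 3 \<le> x3 ^ 3"
    proof -
      have "645/100 * t ^ 3 \<le> (1862/1000 * t) ^ 3" using t by (simp add: power_mult_distrib power_divide)
      also have "\<dots> \<le> x3 ^ 3" using t x3 by (intro power_mono) auto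
      finally show ?thesis .
    qed
    have "t ^ 4 * (645/100 * t ^ 3) \<le> t ^ 4 * x3 ^ 3" using t x33 by (intro mult_left_mono) auto
    also have "\<dots> \<le> 232/100 * x4" using near_axis_gap [of t x3 y3 x4 y4] t n d x by auto
    finally have "645/100 * t ^ 7 \<le> 232/100 * x4" by (simp flip: power_add)
    moreover have "t ^ 7 \<ge> 0" using t by simp
    ultimately have x4': "278/100 * t ^ 7 \<le> x4" by linarith
    have "1 \<le> x3 * \<bar>y4\<bar> + x4 * \<bar>y3\<bar>"
      using d(4) pos abs_triangle_ineq4 [of "x3 * y4" "x4 * y3"] by (simp add: abs_mult)
    moreover have "x4 * \<bar>y3\<bar> \<le> 486/1000 * R"
    proof -
      have "t ^ 7 * (645/100 * \<bar>y3\<bar>) = t ^ 4 * ((645/100 * t ^ 3) * \<bar>y3\<bar>)"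
        by (simp add: mult_ac flip: power_add)
      also have "\<dots> \<le> t ^ 4 * (x3 ^ 3 * \<bar>y3\<bar>)"
        using t x33 by (intro mult_left_mono mult_right_mono) auto
      also have "\<dots> \<le> 116/100" by (rule pos)
      finally have "645/100 * (t ^ 7 * \<bar>y3\<bar>) \<le> 116/100" by (simp only: mult_ac)
      then have *: "t ^ 7 * \<bar>y3\<bar> \<le> 18/100" by linarith
      have "x4 * \<bar>y3\<bar> \<le> 27/10 * t ^ 11 * \<bar>y3\<bar>" using x4 by (intro mult_right_mono) auto
      also have "\<dots> = 27/10 * R * (t ^ 7 * \<bar>y3\<bar>)" by (simp add: R_def flip: power_add)
      also have "\<dots> \<le> 27/10 * R * (18/100)" using * R by (intro mult_left_mono) auto
      finally show ?thesis by simp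
    qed
    moreover have "R ^ 4 * (x3 * \<bar>y4\<bar>) \<le> 151/1000"
    proof -
      \<comment> \<open>The exponent 18 is 4 + 2 * 7: two factors \<open>t ^ 7\<close> are bounded
        by \<open>x4\<close> through \<open>x4'\<close>, and \<open>t ^ 4\<close> belongs to the
        bound on \<open>x4 ^ 3 * \<bar>y4\<bar>\<close>.\<close>
      have "R ^ 4 * (x3 * \<bar>y4\<bar>) \<le> t ^ 18 * (x4 * \<bar>y4\<bar>)"
        unfolding R_def power_mult [symmetric] using t x pos
        by (intro mult_mono mult_right_mono power_increasing) auto
      also have "\<dots> = t ^ 4 * ((t ^ 7)\<^sup>2 * x4 * \<bar>y4\<bar>)" by (simp add: mult_ac flip: power_add power_mult)
      also have "\<dots> = t ^ 4 * ((278/100 * t ^ 7)\<^sup>2 * x4 * \<bar>y4\<bar>) / (278/100)\<^sup>2"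
        unfolding power_mult_distrib by simp
      also have "\<dots> \<le> t ^ 4 * (x4\<^sup>2 * x4 * \<bar>y4\<bar>) / (278/100)\<^sup>2"
        using t x4' pos by (intro divide_right_mono mult_left_mono mult_right_mono power_mono) auto
      also have "\<dots> = t ^ 4 * (x4 ^ 3 * \<bar>y4\<bar>) / (278/100)\<^sup>2" by (simp add: eval_nat_numeral)
      also have "\<dots> \<le> 116/100 / (278/100)\<^sup>2" using pos by (intro divide_right_mono) auto
      finally show ?thesis by (simp add: power_divide)
    qed
    moreover have "0 \<le> x3 * \<bar>y4\<bar>" using pos by simp
    ultimately have *: "1 \<le> x3 * \<bar>y4\<bar> + 486/1000 * R" "R ^ 4 * (x3 * \<bar>y4\<bar>) \<le> 151/1000" "0 \<le> x3 * \<bar>y4\<bar>"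
      by linarith+
    show False
    \<comment> \<open>Up to 17/10 the sum of the two bounds is below 1 even with
      \<open>R ^ 4\<close> replaced by 1; beyond it \<open>R ^ 4\<close> makes the first summand
      small enough for all \<open>R < 2\<close>.\<close>
    proof (cases "R \<le> 17/10")
      case True
      have "1 * (x3 * \<bar>y4\<bar>) \<le> R ^ 4 * (x3 * \<bar>y4\<bar>)" using R * by (intro mult_right_mono) auto
      then show False using * True by linarith
    next
      case False
      have "(17/10) ^ 4 * (x3 * \<bar>y4\<bar>) \<le> R ^ 4 * (x3 * \<bar>y4\<bar>)"
        using False * by (intro mult_right_mono power_mono) auto
      then have "x3 * \<bar>y4\<bar> \<le> 19/1000" using * by (simp add: power_divide)
      then show False using * R by linarith
    qed
  qed
qed

lemma max_element:
  fixes X :: "'a \<Rightarrow> real"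
  assumes "finite S" "card S = Suc n"
  obtains p where "p \<in> S" "\<And>q. q \<in> S \<Longrightarrow> X q \<le> X p" "finite (S - {p})" "card (S - {p}) = n"
proof -
  have "S \<noteq> {}" using assms by auto
  then have "Max (X ` S) \<in> X ` S" using assms by (intro Max_in) auto
  then obtain p where "p \<in> S" "X p = Max (X ` S)" by auto
  show ?thesis
  proof (rule that [OF \<open>p \<in> S\<close>])
    show "X q \<le> X p" if "q \<in> S" for q
      unfolding \<open>X p = Max (X ` S)\<close> using assms(1) that by (intro Max_ge) auto
  qed (use assms \<open>p \<in> S\<close> in auto)
qed

text \<open>A cubing step takes an exponent e to 3 e + 4, which exceeds the next value of
  \<open>4 * 3 ^ j - 1\<close> by two, and \<open>(27/10) ^ 3\<close> outweighs 232/100 times 27/10.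
  The case of four points is a second base case, because three points give a start only if
  \<open>t ^ 4 \<ge> 2\<close>.\<close>

lemma near_axis_large:
  fixes X Y :: "'a \<Rightarrow> real"
  assumes t: "t \<ge> 1" and "finite S" "card S = j + 3" and j: "j = 0 \<Longrightarrow> t ^ 4 \<ge> 2"
    and n: "\<And>p. p \<in> S \<Longrightarrow> near_axis t (X p) (Y p)"
    and d: "\<And>p q. p \<in> S \<Longrightarrow> q \<in> S \<Longrightarrow> p \<noteq> q \<Longrightarrow> 1 \<le> \<bar>X p * Y q - X q * Y p\<bar>"
  shows "\<exists>p\<in>S. 27/10 * t ^ (4 * 3 ^ j - 1) \<le> X p"
  using assms(2-)
proof (induction j arbitrary: S)
  case 0
  have c: "card S = Suc (Suc (Suc 0))" using 0 by simp
  obtain p3 where p3: "p3 \<in> S" "\<And>q. q \<in> S \<Longrightarrow> X q \<le> X p3" "finite (S - {p3})" "card (S - {p3}) = Suc (Suc 0)"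
    by (rule max_element [OF \<open>finite S\<close> c, of X]) blast
  obtain p2 where p2: "p2 \<in> S - {p3}" "\<And>q. q \<in> S - {p3} \<Longrightarrow> X q \<le> X p2"
      "finite (S - {p3} - {p2})" "card (S - {p3} - {p2}) = Suc 0"
    by (rule max_element [OF p3(3,4), of X]) blast
  obtain p1 where p1: "p1 \<in> S - {p3} - {p2}"
    by (rule max_element [OF p2(3,4), of X]) blast
  have "145/100 * t ^ 7 \<le> X p3"
  proof (rule near_axis_three' [of t "X p1" "Y p1" "X p2" "Y p2" "X p3" "Y p3"])
    show "X p1 \<le> X p2" "X p2 \<le> X p3" using p1 p2(1) by (blast intro: p2(2) p3(2))+
    show "near_axis t (X p1) (Y p1)" "near_axis t (X p2) (Y p2)" "near_axis t (X p3) (Y p3)"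
      using p1 p2(1) p3(1) by (blast intro: 0)+
    show "1 \<le> \<bar>X p1 * Y p2 - X p2 * Y p1\<bar>" "1 \<le> \<bar>X p2 * Y p3 - X p3 * Y p2\<bar>"
      using p1 p2(1) p3(1) by (auto intro!: 0(5))
  qed (use t 0 in auto)
  moreover have "2 * t ^ 3 \<le> t ^ 4 * t ^ 3" using t 0 by (intro mult_right_mono) auto
  moreover have "t ^ 4 * t ^ 3 = t ^ 7" "t ^ 3 \<ge> 0" using t by (simp_all flip: power_add)
  ultimately have "27/10 * t ^ 3 \<le> X p3" by linarith
  then show ?case using p3(1) by (intro bexI [of _ p3]) simp_all
next
  case (Suc j)
  show ?case
  proof (cases "j = 0")
    case True
    have c: "card S = Suc (Suc (Suc (Suc 0)))" using Suc True by simp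
    obtain p4 where p4: "p4 \<in> S" "\<And>q. q \<in> S \<Longrightarrow> X q \<le> X p4" "finite (S - {p4})" "card (S - {p4}) = Suc (Suc (Suc 0))"
      by (rule max_element [OF \<open>finite S\<close> c, of X]) blast
    obtain p3 where p3: "p3 \<in> S - {p4}" "\<And>q. q \<in> S - {p4} \<Longrightarrow> X q \<le> X p3"
        "finite (S - {p4} - {p3})" "card (S - {p4} - {p3}) = Suc (Suc 0)"
      by (rule max_element [OF p4(3,4), of X]) blast
    obtain p2 where p2: "p2 \<in> S - {p4} - {p3}" "\<And>q. q \<in> S - {p4} - {p3} \<Longrightarrow> X q \<le> X p2"
        "finite (S - {p4} - {p3} - {p2})" "card (S - {p4} - {p3} - {p2}) = Suc 0"
      by (rule max_element [OF p3(3,4), of X]) blast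
    obtain p1 where p1: "p1 \<in> S - {p4} - {p3} - {p2}"
      by (rule max_element [OF p2(3,4), of X]) blast
    have "27/10 * t ^ 11 \<le> X p4"
    proof (rule near_axis_four [of t "X p1" "Y p1" "X p2" "Y p2" "X p3" "Y p3" "X p4" "Y p4"])
      show "X p1 \<le> X p2" "X p2 \<le> X p3" "X p3 \<le> X p4"
        using p1 p2(1) p3(1) by (blast intro: p2(2) p3(2) p4(2))+
      show "near_axis t (X p1) (Y p1)" "near_axis t (X p2) (Y p2)" "near_axis t (X p3) (Y p3)"
        "near_axis t (X p4) (Y p4)"
        using p1 p2(1) p3(1) p4(1) by (blast intro: Suc.prems)+
      show "1 \<le> \<bar>X p1 * Y p2 - X p2 * Y p1\<bar>" "1 \<le> \<bar>X p1 * Y p3 - X p3 * Y p1\<bar>"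
        "1 \<le> \<bar>X p2 * Y p3 - X p3 * Y p2\<bar>" "1 \<le> \<bar>X p3 * Y p4 - X p4 * Y p3\<bar>"
        using p1 p2(1) p3(1) p4(1) by (auto intro!: Suc.prems(5))
    qed (use t in auto)
    then show ?thesis using p4(1) True by (intro bexI [of _ p4]) simp_all
  next
    case False
    have c: "card S = Suc (j + 3)" using Suc by simp
    obtain p where p: "p \<in> S" "\<And>q. q \<in> S \<Longrightarrow> X q \<le> X p" "finite (S - {p})" "card (S - {p}) = j + 3"
      by (rule max_element [OF \<open>finite S\<close> c, of X]) blast
    have "\<exists>q\<in>S - {p}. 27/10 * t ^ (4 * 3 ^ j - 1) \<le> X q"
      by (rule Suc.IH) (use p(3,4) False in \<open>auto intro: Suc.prems\<close>)
    then obtain q where q: "q \<in> S" "q \<noteq> p" "27/10 * t ^ (4 * 3 ^ j - 1) \<le> X q" by auto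
    have "t ^ 4 * (27/10 * t ^ (4 * 3 ^ j - 1)) ^ 3 \<le> t ^ 4 * X q ^ 3"
      using q t by (intro mult_left_mono power_mono) auto
    also have "\<dots> \<le> 232/100 * X p"
    proof (rule near_axis_gap [of t "X q" "Y q" "X p" "Y p"])
      show "near_axis t (X q) (Y q)" "near_axis t (X p) (Y p)" using p(1) q(1) by (blast intro: Suc.prems)+
      show "1 \<le> \<bar>X q * Y p - X p * Y q\<bar>" using p(1) q by (intro Suc.prems(5))
    qed (use t p(2) q in auto)
    also have "t ^ 4 * (27/10 * t ^ (4 * 3 ^ j - 1)) ^ 3 = (27/10) ^ 3 * (t ^ 4 * t ^ (3 * (4 * 3 ^ j - 1)))"
    proof -
      have eq: "t ^ (3 * e) = (t ^ e) ^ 3" for e by (simp add: mult.commute flip: power_mult)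
      show ?thesis unfolding eq power_mult_distrib by (rule mult.left_commute)
    qed
    finally have 1: "(27/10) ^ 3 * (t ^ 4 * t ^ (3 * (4 * 3 ^ j - 1))) \<le> 232/100 * X p" .
    have "4 * 3 ^ Suc j - 1 \<le> 4 + 3 * (4 * 3 ^ j - 1 :: nat)" by simp
    then have "t ^ (4 * 3 ^ Suc j - 1) \<le> t ^ 4 * t ^ (3 * (4 * 3 ^ j - 1))"
      unfolding power_add [symmetric] using t(1) by (rule power_increasing)
    then have "(27/10) ^ 3 * t ^ (4 * 3 ^ Suc j - 1) \<le> 232/100 * X p"
      by (intro order_trans [OF _ 1] mult_left_mono) auto
    moreover have "t ^ (4 * 3 ^ Suc j - 1) \<ge> 0" using t by simp
    moreover have num: "(27/10) ^ 3 = (19683/1000 :: real)" by (simp add: power_divide)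
    ultimately have "27/10 * t ^ (4 * 3 ^ Suc j - 1) \<le> X p" unfolding num by linarith
    then show ?thesis using p(1) by blast
  qed
qed

section \<open>Arithmetic of quartic forms with vanishing J\<close>

text \<open>A rational zero splits off a linear factor. Both factors vanish at the origin, so
  neither is a unit of the bivariate polynomial ring.\<close>

lemma quartic_form_nonzero:
  fixes x y :: int
  assumes irr: "quartic_irreducible_over_rat a0 a1 a2 a3 a4" and xy: "x \<noteq> 0 \<or> y \<noteq> 0"
  shows "quartic_form a0 a1 a2 a3 a4 x y \<noteq> (0::int)"
proof
  assume 0: "quartic_form a0 a1 a2 a3 a4 x y = (0::int)"
  define X Y :: "rat poly poly" where "X = [:[:0, 1:]:]" and "Y = [:0, 1:]"
  have unit0: "p dvd 1 \<Longrightarrow> coeff p 0 dvd 1" for p :: "rat poly poly"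
    by (metis is_unit_poly_iff coeff_pCons_0 is_unit_pCons_iff)
  have irr': "irreducible (quartic_form a0 a1 a2 a3 a4 X Y)"
    using irr by (simp add: quartic_irreducible_over_rat_def X_def Y_def)
  show False
  proof (cases "y = 0")
    case True
    then have "a0 = 0" using 0 xy by (simp add: quartic_form_def)
    define P where "P = of_int a1 * X ^ 3 + of_int a2 * X ^ 2 * Y + of_int a3 * X * Y ^ 2 + of_int a4 * Y ^ 3"
    have "quartic_form a0 a1 a2 a3 a4 X Y = Y * P"
      by (simp add: quartic_form_def \<open>a0 = 0\<close> P_def algebra_simps eval_nat_numeral)
    then have "Y dvd 1 \<or> P dvd 1" using irr' irreducibleD by blast
    moreover have "coeff Y 0 = 0" by (simp add: Y_def)
    moreover have "poly (coeff P 0) 0 = 0" by (simp add: P_def Y_def X_def coeff_mult_0 coeff_0_power)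
    ultimately show False using unit0 [of Y] unit0 [of P]
      by (metis dvd_0_left_iff one_neq_zero poly_1 poly_0 dvdE mult_zero_left poly_mult)
  next
    case False
    define s :: rat where "s = of_int x / of_int y"
    define S :: "rat poly poly" where "S = [:[:s:]:]"
    have "of_int (quartic_form a0 a1 a2 a3 a4 x y) / of_int y ^ 4 = (quartic_form a0 a1 a2 a3 a4 s 1 :: rat)"
      using False by (simp add: quartic_form_def s_def field_simps eval_nat_numeral)
    then have s: "quartic_form a0 a1 a2 a3 a4 s 1 = 0" using 0 by simp
    have "quartic_form a0 a1 a2 a3 a4 S 1 = [:[:quartic_form a0 a1 a2 a3 a4 s 1:]:]"
      by (simp add: quartic_form_def S_def eval_nat_numeral of_int_poly algebra_simps)
    then have S: "quartic_form a0 a1 a2 a3 a4 S 1 = 0" by (simp add: s)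
    define P where "P = of_int a0 * X ^ 3 + (of_int a1 + of_int a0 * S) * X ^ 2 * Y
       + (of_int a2 + of_int a1 * S + of_int a0 * S ^ 2) * X * Y ^ 2
       + (of_int a3 + of_int a2 * S + of_int a1 * S ^ 2 + of_int a0 * S ^ 3) * Y ^ 3"
    have "quartic_form a0 a1 a2 a3 a4 X Y - Y ^ 4 * quartic_form a0 a1 a2 a3 a4 S 1 = (X - S * Y) * P"
      unfolding quartic_form_def P_def by (simp add: algebra_simps eval_nat_numeral)
    then have "quartic_form a0 a1 a2 a3 a4 X Y = (X - S * Y) * P" by (simp add: S)
    then have "(X - S * Y) dvd 1 \<or> P dvd 1" using irr' irreducibleD by blast
    moreover have "poly (coeff (X - S * Y) 0) 0 = 0" by (simp add: S_def X_def Y_def coeff_mult_0)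
    moreover have "poly (coeff P 0) 0 = 0"
      by (simp add: P_def Y_def X_def coeff_mult_0 coeff_0_power)
    ultimately show False using unit0 [of "X - S * Y"] unit0 [of P]
      by (metis dvd_0_left_iff one_neq_zero poly_1 poly_0 dvdE mult_zero_left poly_mult)
  qed
qed

text \<open>The left side is \<open>a0 ^ 2\<close> times the sum of squared root differences. It
  vanishes only for a fourfold root, and then the invariant I is 0 too.\<close>

lemma quartic_hessian_pos:
  assumes "a0 \<noteq> 0" and I: "quartic_I a0 a1 a2 a3 a4 > 0"
    and roots: "\<forall>z::complex. quartic_form a0 a1 a2 a3 a4 z 1 = 0 \<longrightarrow> z \<in> \<real>"
  shows "3 * a1 ^ 2 - 8 * a0 * a2 > 0"
proof -
  define p :: "complex poly" where "p = [:of_int a4, of_int a3, of_int a2, of_int a1, of_int a0:]"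
  have deg: "degree p = 4" using \<open>a0 \<noteq> 0\<close> by (simp add: p_def)
  have lead: "lead_coeff p = of_int a0" unfolding deg by (simp add: p_def eval_nat_numeral)
  obtain M where M: "size M = degree p" "p = smult (lead_coeff p) (\<Prod>x\<in>#M. [:- x, 1:])"
    using alg_closed_imp_factorization [of p] \<open>a0 \<noteq> 0\<close> by (auto simp: p_def)
  have "size M = Suc (Suc (Suc (Suc 0)))" using M deg by simp
  then obtain z1 M1 where "M = add_mset z1 M1" "size M1 = Suc (Suc (Suc 0))"
    by (metis size_eq_Suc_imp_eq_union size_add_mset nat.inject)
  moreover then obtain z2 M2 where "M1 = add_mset z2 M2" "size M2 = Suc (Suc 0)"
    by (metis size_eq_Suc_imp_eq_union size_add_mset nat.inject)
  moreover then obtain z3 M3 where "M2 = add_mset z3 M3" "size M3 = Suc 0"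
    by (metis size_eq_Suc_imp_eq_union size_add_mset nat.inject)
  moreover then obtain z4 where "M3 = {#z4#}"
    by (metis size_eq_Suc_imp_eq_union size_add_mset nat.inject size_eq_0_iff_empty)
  ultimately have Mz: "M = {#z1, z2, z3, z4#}" by simp
  have real: "z \<in> \<real>" if "z \<in># M" for z
  proof -
    have "poly p z = 0" using that by (subst M(2)) (auto simp: poly_prod_mset)
    then show ?thesis using roots by (simp add: p_def quartic_form_def algebra_simps eval_nat_numeral)
  qed
  obtain r1 r2 r3 r4 where r: "z1 = of_real r1" "z2 = of_real r2" "z3 = of_real r3" "z4 = of_real r4"
    using real [of z1] real [of z2] real [of z3] real [of z4] Mz by (auto elim!: Reals_cases)
  have p: "p = smult (of_int a0) ([:- z1, 1:] * ([:- z2, 1:] * ([:- z3, 1:] * [:- z4, 1:])))"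
    using M(2) unfolding lead Mz by simp
  have "of_int a1 = complex_of_real (- of_int a0 * (r1 + r2 + r3 + r4))"
    "of_int a2 = complex_of_real (of_int a0 * (r1*r2 + r1*r3 + r1*r4 + r2*r3 + r2*r4 + r3*r4))"
    "of_int a3 = complex_of_real (- of_int a0 * (r1*r2*r3 + r1*r2*r4 + r1*r3*r4 + r2*r3*r4))"
    "of_int a4 = complex_of_real (of_int a0 * (r1*r2*r3*r4))"
    using p unfolding p_def r by (simp_all add: algebra_simps)
  then have a: "real_of_int a1 = - of_int a0 * (r1 + r2 + r3 + r4)"
    "real_of_int a2 = of_int a0 * (r1*r2 + r1*r3 + r1*r4 + r2*r3 + r2*r4 + r3*r4)"
    "real_of_int a3 = - of_int a0 * (r1*r2*r3 + r1*r2*r4 + r1*r3*r4 + r2*r3*r4)"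
    "real_of_int a4 = of_int a0 * (r1*r2*r3*r4)"
    by (metis of_real_of_int_eq of_real_eq_iff)+
  define T where "T = (r1-r2)^2 + (r1-r3)^2 + (r1-r4)^2 + (r2-r3)^2 + (r2-r4)^2 + (r3-r4)^2"
  have eq: "real_of_int (3 * a1 ^ 2 - 8 * a0 * a2) = of_int a0 ^ 2 * T"
    unfolding T_def by (simp add: a power2_eq_square algebra_simps)
  have "T \<ge> 0" by (simp add: T_def)
  moreover have "T \<noteq> 0"
  proof
    assume "T = 0"
    then have "r1 = r2" "r3 = r2" "r4 = r2"
      by (auto simp: T_def add_nonneg_eq_0_iff)
    then have "real_of_int (quartic_I a0 a1 a2 a3 a4) = 0"
      by (simp add: quartic_I_def a power2_eq_square algebra_simps)
    then show False using I by simp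
  qed
  ultimately have "real_of_int (3 * a1 ^ 2 - 8 * a0 * a2) > 0"
    unfolding eq using \<open>a0 \<noteq> 0\<close> by simp
  then show ?thesis by linarith
qed

lemma dvd_fourth_powers:
  fixes k m x y z :: int
  assumes "k dvd m * x ^ 4" "k dvd m * y ^ 4" "k dvd m * z ^ 4" "gcd (gcd x y) z = 1"
  shows "k dvd m"
proof -
  have *: "k dvd m * gcd a b" if "k dvd m * a" "k dvd m * b" for a b
    using gcd_greatest [OF that] by (simp add: gcd_mult_left)
  have "k dvd m * gcd (gcd (x ^ 4) (y ^ 4)) (z ^ 4)"
    using assms by (intro *)
  then show ?thesis by (simp add: gcd_exp assms(4))
qed

text \<open>The vanishing of \<open>J\<close> is the existence of a quadratic form \<open>A x\<^sup>2 + B x y + C y\<^sup>2\<close>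
  apolar to the quartic.\<close>

lemma apolar_quadratic:
  fixes a0 a1 a2 a3 a4 :: int
  assumes J: "quartic_J a0 a1 a2 a3 a4 = 0" and pos: "3 * a1 ^ 2 - 8 * a0 * a2 > 0"
  obtains A B C :: int where "A > 0" "gcd (gcd A C) (A + B + C) = 1"
    "12 * C * a0 - 3 * B * a1 + 2 * A * a2 = 0"
    "6 * C * a1 - 4 * B * a2 + 6 * A * a3 = 0"
    "2 * C * a2 - 3 * B * a3 + 12 * A * a4 = 0"
proof -
  \<comment> \<open>Half the cross product of the first two equations, viewed as linear in the three
    unknowns. These two hold identically; substituted into the third, it gives a multiple of
    J.\<close>
  define A' B' C' where "A' = 9 * a1 ^ 2 - 24 * a0 * a2" and "B' = 6 * a1 * a2 - 36 * a0 * a3"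
    and "C' = 4 * a2 ^ 2 - 9 * a1 * a3"
  \<comment> \<open>The entries are the values of the quadratic form at (1,0), (0,1) and (1,1). They
    generate the same ideal as its coefficients and are what \<open>E_le\<close> evaluates.\<close>
  define g where "g = gcd (gcd A' C') (A' + B' + C')"
  have "A' > 0" using pos by (simp add: A'_def)
  then have g: "g > 0" by (simp add: g_def)
  have "g dvd A'" "g dvd C'" "g dvd A' + B' + C'"
    unfolding g_def by (rule dvd_trans [OF gcd_dvd1 gcd_dvd1] dvd_trans [OF gcd_dvd1 gcd_dvd2] gcd_dvd2)+
  moreover have "g dvd (A' + B' + C') - A' - C'" using calculation by (intro dvd_diff)
  then have "g dvd B'" by simp
  ultimately obtain A B C where ABC: "A' = g * A" "B' = g * B" "C' = g * C" by (auto elim!: dvdE)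
  have "g = gcd (gcd A' C') (A' + B' + C')" by (rule g_def)
  also have "\<dots> = gcd (gcd (g * A) (g * C)) (g * (A + B + C))"
    by (simp only: ABC distrib_left)
  also have "\<dots> = g * gcd (gcd A C) (A + B + C)"
    using g by (simp only: gcd_mult_left) (simp add: gcd_mult_left)
  finally have "gcd (gcd A C) (A + B + C) = 1" using g by simp
  moreover have "A > 0" using \<open>A' > 0\<close> g by (simp add: ABC zero_less_mult_iff)
  moreover have "12 * C' * a0 - 3 * B' * a1 + 2 * A' * a2 = 0"
    "6 * C' * a1 - 4 * B' * a2 + 6 * A' * a3 = 0"
    by (simp_all add: A'_def B'_def C'_def algebra_simps power2_eq_square)
  moreover have "2 * C' * a2 - 3 * B' * a3 + 12 * A' * a4 = 4 * quartic_J a0 a1 a2 a3 a4"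
    by (simp add: A'_def B'_def C'_def quartic_J_def algebra_simps power2_eq_square power3_eq_cube)
  then have "2 * C' * a2 - 3 * B' * a3 + 12 * A' * a4 = 0" by (simp add: J)
  ultimately have "g * (12 * C * a0 - 3 * B * a1 + 2 * A * a2) = 0"
    "g * (6 * C * a1 - 4 * B * a2 + 6 * A * a3) = 0"
    "g * (2 * C * a2 - 3 * B * a3 + 12 * A * a4) = 0"
    unfolding ABC by (simp_all add: algebra_simps)
  with g have "12 * C * a0 - 3 * B * a1 + 2 * A * a2 = 0"
    "6 * C * a1 - 4 * B * a2 + 6 * A * a3 = 0"
    "2 * C * a2 - 3 * B * a3 + 12 * A * a4 = 0" by auto
  with \<open>A > 0\<close> \<open>gcd (gcd A C) (A + B + C) = 1\<close> show ?thesis by (rule that)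
qed

lemma Im_of_real_mult: "Im (of_real x * z) = x * Im z"
  by simp

section \<open>The fourth-power structure of an apolar pair\<close>

locale apolar_pair =
  fixes a0 a1 a2 a3 a4 A B C :: int
  assumes A: "A > 0" and prim: "gcd (gcd A C) (A + B + C) = 1"
    and h1: "12 * C * a0 - 3 * B * a1 + 2 * A * a2 = 0"
    and h2: "6 * C * a1 - 4 * B * a2 + 6 * A * a3 = 0"
    and h3: "2 * C * a2 - 3 * B * a3 + 12 * A * a4 = 0"
    and I: "quartic_I a0 a1 a2 a3 a4 > 0" and hess: "3 * a1 ^ 2 - 8 * a0 * a2 > 0"
begin

definition E :: int where "E = 4 * A * C - B ^ 2"

text \<open>Half the Jacobian of the apolar quadratic form and the quartic form.\<close>

definition jac :: "int \<Rightarrow> int \<Rightarrow> int" where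
  "jac x y = (A * a1 - 2 * B * a0) * x ^ 4 + (2 * A * a2 - B * a1 - 4 * C * a0) * x ^ 3 * y
     + 3 * (A * a3 - C * a1) * x ^ 2 * y ^ 2 + (4 * A * a4 + B * a3 - 2 * C * a2) * x * y ^ 3
     + (2 * B * a4 - C * a3) * y ^ 4"

abbreviation form :: "int \<Rightarrow> int \<Rightarrow> int" where
  "form \<equiv> quartic_form a0 a1 a2 a3 a4"

text \<open>A complex linear factor of \<open>A\<close> times the quadratic form:
  \<open>norm_lin\<close> shows that its squared modulus is this product.\<close>

definition lin :: "int \<Rightarrow> int \<Rightarrow> complex" where
  "lin x y = of_real (of_int A * of_int x + of_int B / 2 * of_int y)
     + \<i> * of_real (sqrt (of_int E) / 2 * of_int y)"

definition rt :: complex where "rt = \<i> * of_real (sqrt (of_int E))"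

text \<open>Up to a constant the fourth power of \<open>lin\<close>; the quartic and its covariant
  \<open>jac\<close> are the components of this power in Z[rt].\<close>

definition kap :: "int \<Rightarrow> int \<Rightarrow> complex" where
  "kap x y = of_int (jac x y) + 2 * of_int (form x y) * rt"

definition c :: real where "c = sqrt (of_int (quartic_I a0 a1 a2 a3 a4) / 3)"

text \<open>The source of \<open>E > 0\<close>, that is, of the definiteness of the quadratic form,
  which makes \<open>rt\<close> imaginary and the values of \<open>lin\<close> a planar
  lattice.\<close>

lemma hess_E: "(3 * a1 ^ 2 - 8 * a0 * a2) * E = 4 * quartic_I a0 a1 a2 a3 a4 * A ^ 2"
proof -
  have "3 * ((3 * a1 ^ 2 - 8 * a0 * a2) * E) = 3 * (4 * quartic_I a0 a1 a2 a3 a4 * A ^ 2)"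
    using h1 h2 h3 unfolding E_def quartic_I_def by algebra
  then show ?thesis by (simp only: mult_cancel_left) simp
qed

lemma E_pos: "E > 0"
proof -
  have "(3 * a1 ^ 2 - 8 * a0 * a2) * E > 0" unfolding hess_E using I A by simp
  then show ?thesis using hess by (simp add: zero_less_mult_iff)
qed

lemma jac_1_0: "3 * E * (jac 1 0 ^ 2 + 4 * E * form 1 0 ^ 2) = 4 * quartic_I a0 a1 a2 a3 a4 * A ^ 4"
proof -
  have "3 * (jac 1 0 ^ 2 + 4 * E * form 1 0 ^ 2) = A ^ 2 * (3 * a1 ^ 2 - 8 * a0 * a2)"
    using h1 unfolding E_def jac_def quartic_form_def by simp algebra
  then have "E * (3 * (jac 1 0 ^ 2 + 4 * E * form 1 0 ^ 2)) = E * (A ^ 2 * (3 * a1 ^ 2 - 8 * a0 * a2))"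
    by (simp only:)
  also have "\<dots> = A ^ 2 * ((3 * a1 ^ 2 - 8 * a0 * a2) * E)" by (simp only: mult_ac)
  also have "\<dots> = 4 * quartic_I a0 a1 a2 a3 a4 * A ^ 4" unfolding hess_E by (simp add: eval_nat_numeral)
  finally show ?thesis by (simp only: mult_ac)
qed

lemma rt_sq: "rt * rt = of_int (- E)"
proof -
  have "rt * rt = (\<i> * \<i>) * of_real (sqrt (of_int E) * sqrt (of_int E))"
    unfolding rt_def of_real_mult by (simp only: mult_ac)
  also have "\<dots> = of_int (- E)" using E_pos by (subst real_sqrt_mult_self) simp
  finally show ?thesis .
qed

lemma lin_eq: "2 * lin x y = 2 * of_int A * of_int x + (of_int B + rt) * of_int y"
  by (simp add: lin_def rt_def algebra_simps)

text \<open>Since \<open>lin\<close> is \<open>A\<close> times x + (b / (2 A)) y, the claim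
  prescribes the ratios of consecutive coefficients of \<open>kap\<close>. Each ratio follows from
  the apolarity equations and the value of \<open>rt * rt\<close>.\<close>

lemma kap_lin: "of_int A ^ 4 * kap x y = kap 1 0 * lin x y ^ 4"
proof -
  define a0' a1' a2' a3' a4' A' B' C' x' y' :: complex where
    "a0' = of_int a0" "a1' = of_int a1" "a2' = of_int a2" "a3' = of_int a3" "a4' = of_int a4"
    "A' = of_int A" "B' = of_int B" "C' = of_int C" "x' = of_int x" "y' = of_int y"
  note defs = this
  have r1: "12 * C' * a0' - 3 * B' * a1' + 2 * A' * a2' = 0"
    using arg_cong [OF h1, of "of_int :: int \<Rightarrow> complex"] by (simp add: defs)
  have r2: "6 * C' * a1' - 4 * B' * a2' + 6 * A' * a3' = 0"
    using arg_cong [OF h2, of "of_int :: int \<Rightarrow> complex"] by (simp add: defs)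
  have r3: "2 * C' * a2' - 3 * B' * a3' + 12 * A' * a4' = 0"
    using arg_cong [OF h3, of "of_int :: int \<Rightarrow> complex"] by (simp add: defs)
  have s: "rt * rt = B' ^ 2 - 4 * A' * C'" by (simp add: rt_sq E_def defs)
  define b k0 k1 k2 k3 k4 where
    "b = B' + rt"
    "k0 = A' * a1' - 2 * B' * a0' + 2 * a0' * rt"
    "k1 = 2 * A' * a2' - B' * a1' - 4 * C' * a0' + 2 * a1' * rt"
    "k2 = 3 * (A' * a3' - C' * a1') + 2 * a2' * rt"
    "k3 = 4 * A' * a4' + B' * a3' - 2 * C' * a2' + 2 * a3' * rt"
    "k4 = 2 * B' * a4' - C' * a3' + 2 * a4' * rt"
  note kd = this
  have e1: "A' * k1 = 2 * b * k0" unfolding kd using r1 s by algebra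
  have e2: "4 * A' * k2 = 3 * b * k1" unfolding kd using r1 r2 s by algebra
  have e3: "3 * A' * k3 = b * k2" unfolding kd using r1 r2 r3 s by algebra
  have e4: "8 * A' * k4 = b * k3" unfolding kd using r1 r2 r3 s by algebra
  have kap: "kap x y = k0 * x' ^ 4 + k1 * x' ^ 3 * y' + k2 * x' ^ 2 * y' ^ 2 + k3 * x' * y' ^ 3 + k4 * y' ^ 4"
    by (simp add: kap_def jac_def quartic_form_def kd defs algebra_simps)
  have kap0: "kap 1 0 = k0" by (simp add: kap_def jac_def quartic_form_def kd defs)
  have f: "A' * A' * k2 * 2 = 3 * b ^ 2 * k0" using e1 e2 by algebra
  have f3: "2 * A' ^ 3 * k3 = b ^ 3 * k0" using e3 f by algebra
  have f4: "16 * A' ^ 4 * k4 = b ^ 4 * k0" using e4 f3 by algebra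
  have "16 * (A' ^ 4 * kap x y) = k0 * (2 * A' * x' + b * y') ^ 4"
  proof -
    have "16 * (A' ^ 4 * kap x y) = 16 * A' ^ 4 * k0 * x' ^ 4 + 16 * A' ^ 3 * (A' * k1) * x' ^ 3 * y'
       + 8 * A' ^ 2 * (A' * A' * k2 * 2) * x' ^ 2 * y' ^ 2 + 8 * A' * (2 * A' ^ 3 * k3) * x' * y' ^ 3
       + (16 * A' ^ 4 * k4) * y' ^ 4"
      unfolding kap by algebra
    also have "\<dots> = k0 * (2 * A' * x' + b * y') ^ 4"
      unfolding e1 f f3 f4 by algebra
    finally show ?thesis .
  qed
  also have "2 * A' * x' + b * y' = 2 * lin x y" unfolding lin_eq by (simp add: kd defs)
  finally show ?thesis by (simp add: kap0 defs power_mult_distrib)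
qed

lemma cnj_rt: "cnj rt = - rt" by (simp add: rt_def)

lemma cnj_kap: "cnj (kap x y) = of_int (jac x y) - 2 * of_int (form x y) * rt"
  by (simp add: kap_def cnj_rt)

lemma norm_kap: "(cmod (kap x y))\<^sup>2 = of_int (jac x y ^ 2 + 4 * E * form x y ^ 2)"
proof -
  have "complex_of_real ((cmod (kap x y))\<^sup>2) = kap x y * cnj (kap x y)"
    by (rule complex_norm_square)
  also have "\<dots> = of_int (jac x y) ^ 2 - 4 * of_int (form x y) ^ 2 * (rt * rt)"
    unfolding cnj_kap by (simp add: kap_def algebra_simps power2_eq_square)
  also have "\<dots> = complex_of_real (of_int (jac x y ^ 2 + 4 * E * form x y ^ 2))"
    unfolding rt_sq by simp
  finally show ?thesis by (simp only: of_real_eq_iff)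
qed

lemma Re_Im_lin:
  "Re (cnj (lin x2 y2) * lin x1 y1)
     = of_int A * of_int (2 * A * x1 * x2 + B * (x1 * y2 + x2 * y1) + 2 * C * y1 * y2) / 2"
  "Im (cnj (lin x2 y2) * lin x1 y1) = of_int A * sqrt (of_int E) / 2 * of_int (x2 * y1 - x1 * y2)"
proof -
  have "sqrt (of_int E) * sqrt (of_int E) = of_int E" using E_pos by simp
  also have "\<dots> = 4 * of_int A * of_int C - (of_int B)\<^sup>2" by (simp add: E_def)
  finally have sq: "sqrt (of_int E) * sqrt (of_int E) = 4 * of_int A * of_int C - (of_int B)\<^sup>2" .
  have "sqrt (of_int E) * u * (sqrt (of_int E) * v) = (4 * of_int A * of_int C - (of_int B)\<^sup>2) * (u * v)"
    for u v :: real unfolding sq [symmetric] by (simp only: mult_ac)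
  from this [of "of_int y1" "of_int y2"]
  show "Re (cnj (lin x2 y2) * lin x1 y1)
     = of_int A * of_int (2 * A * x1 * x2 + B * (x1 * y2 + x2 * y1) + 2 * C * y1 * y2) / 2"
    by (simp add: lin_def field_simps power2_eq_square)
qed (simp add: lin_def field_simps)

lemma norm_lin: "(cmod (lin x y))\<^sup>2 = of_int (A * (A * x ^ 2 + B * x * y + C * y ^ 2))"
proof -
  have "(cmod (lin x y))\<^sup>2 = Re (cnj (lin x y) * lin x y)"
    using arg_cong [OF complex_norm_square [of "lin x y"], of Re] by (simp add: algebra_simps)
  then show ?thesis unfolding Re_Im_lin by (simp add: field_simps power2_eq_square)
qed

text \<open>This syzygy is computed by hand only at (1,0); taking norms in \<open>kap_lin\<close>
  transports it to every point.\<close>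

lemma jac_form: "3 * E * (jac x y ^ 2 + 4 * E * form x y ^ 2)
    = 4 * quartic_I a0 a1 a2 a3 a4 * (A * x ^ 2 + B * x * y + C * y ^ 2) ^ 4"
proof -
  define q where "q = A * x ^ 2 + B * x * y + C * y ^ 2"
  have "(cmod (of_int A ^ 4 * kap x y))\<^sup>2 = (cmod (kap 1 0 * lin x y ^ 4))\<^sup>2" by (simp only: kap_lin)
  then have "of_int A ^ 8 * (cmod (kap x y))\<^sup>2 = (cmod (kap 1 0))\<^sup>2 * ((cmod (lin x y))\<^sup>2) ^ 4"
    by (simp add: norm_mult norm_power power_mult_distrib flip: power_mult)
  then have "of_int (A ^ 8 * (jac x y ^ 2 + 4 * E * form x y ^ 2))
      = (of_int ((jac 1 0 ^ 2 + 4 * E * form 1 0 ^ 2) * (A * q) ^ 4) :: real)"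
    unfolding norm_kap norm_lin q_def by (simp only: of_int_mult of_int_power)
  then have "A ^ 8 * (jac x y ^ 2 + 4 * E * form x y ^ 2) = (jac 1 0 ^ 2 + 4 * E * form 1 0 ^ 2) * (A * q) ^ 4"
    by (simp only: of_int_eq_iff)
  then have "3 * E * (A ^ 8 * (jac x y ^ 2 + 4 * E * form x y ^ 2))
     = (3 * E * (jac 1 0 ^ 2 + 4 * E * form 1 0 ^ 2)) * (A * q) ^ 4" by simp
  also have "\<dots> = A ^ 8 * (4 * quartic_I a0 a1 a2 a3 a4 * q ^ 4)"
    unfolding jac_1_0 by (simp add: power_mult_distrib algebra_simps flip: power_add)
  finally have "A ^ 8 * (3 * E * (jac x y ^ 2 + 4 * E * form x y ^ 2)) = A ^ 8 * (4 * quartic_I a0 a1 a2 a3 a4 * q ^ 4)"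
    by (simp only: mult_ac)
  then show ?thesis using A by (simp add: q_def)
qed

text \<open>Evaluating \<open>jac_form\<close> at (1,0), (0,1), (1,1) shows that
  \<open>3 * E\<close> divides \<open>4 * quartic_I\<close> times the fourth powers of three jointly
  coprime integers. Through \<open>sqrt_E_le\<close> this limits the scale \<open>Q\<close>.\<close>

lemma E_le: "3 * E \<le> 4 * quartic_I a0 a1 a2 a3 a4"
proof (rule zdvd_imp_le)
  show "3 * E dvd 4 * quartic_I a0 a1 a2 a3 a4"
  proof (rule dvd_fourth_powers [OF _ _ _ prim])
    show "3 * E dvd 4 * quartic_I a0 a1 a2 a3 a4 * A ^ 4"
      by (rule dvdI [OF jac_1_0 [symmetric]])
    show "3 * E dvd 4 * quartic_I a0 a1 a2 a3 a4 * C ^ 4"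
      using dvdI [OF jac_form [of 0 1, symmetric]] by simp
    show "3 * E dvd 4 * quartic_I a0 a1 a2 a3 a4 * (A + B + C) ^ 4"
      using dvdI [OF jac_form [of 1 1, symmetric]] by simp
  qed
qed (use I in simp)

text \<open>Multiplication by an element of Z[rt] mixes the real and imaginary parts of the pairing,
  and both kinds of terms come out as multiples of
  \<open>of_int A * sqrt (of_int E) / 2\<close>.\<close>

lemma pade_lin_Ints:
  "2 / (of_int A * sqrt (of_int E)) * Im (cnj (lin x2 y2) * lin x1 y1 *
     (2 ^ r * (\<Sum>j\<le>r. of_real (pade r j) * kap x1 y1 ^ (r - j) * cnj (kap x1 y1) ^ j))) \<in> \<int>"
proof -
  have "2 ^ r * (\<Sum>j\<le>r. of_real (pade r j) * kap x1 y1 ^ (r - j) * cnj (kap x1 y1) ^ j) \<in> int_span rt"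
    unfolding cnj_kap unfolding kap_def by (rule pade_polynomial_int_span [OF rt_sq])
  then obtain p q where pq: "2 ^ r * (\<Sum>j\<le>r. of_real (pade r j) * kap x1 y1 ^ (r - j) * cnj (kap x1 y1) ^ j)
      = of_int p + of_int q * rt" by (auto simp: int_span_def)
  define z where "z = cnj (lin x2 y2) * lin x1 y1"
  have "Im (z * (of_int p + of_int q * rt)) = of_int p * Im z + of_int q * sqrt (of_int E) * Re z"
    by (simp add: rt_def algebra_simps)
  also have "\<dots> = of_int A * sqrt (of_int E) / 2
     * of_int (p * (x2 * y1 - x1 * y2) + q * (2 * A * x1 * x2 + B * (x1 * y2 + x2 * y1) + 2 * C * y1 * y2))"
    unfolding z_def Re_Im_lin by (simp add: algebra_simps add_divide_distrib diff_divide_distrib)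
  finally have eq: "Im (z * (of_int p + of_int q * rt)) = \<dots>" .
  have cancel: "2 / u * (u / 2 * of_int k) \<in> \<int>" if "u \<noteq> 0" for u :: real and k
    using that by simp
  show ?thesis
    unfolding pq z_def [symmetric] eq by (rule cancel) (use A E_pos in simp)
qed

lemma c_pos: "c > 0" and c_sq: "3 * c\<^sup>2 = of_int (quartic_I a0 a1 a2 a3 a4)"
  using I by (simp_all add: c_def)

lemma sqrt_E_le: "sqrt (of_int E) \<le> 2 * c"
proof (rule real_le_lsqrt [THEN order_trans])
  show "of_int E \<le> (2 * c)\<^sup>2"
    using E_le c_sq by (simp add: power_mult_distrib)
qed (use c_pos in auto)

lemma norm_kap_1_0: "cmod (kap 1 0) = 2 * c * of_int A ^ 2 / sqrt (of_int E)"
proof (rule power2_eq_imp_eq)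
  have "3 * of_int E * (cmod (kap 1 0))\<^sup>2 = of_int (4 * quartic_I a0 a1 a2 a3 a4 * A ^ 4)"
    unfolding norm_kap jac_1_0 [symmetric] by simp
  also have "\<dots> = 12 * c\<^sup>2 * of_int A ^ 4" by (simp add: c_sq [symmetric])
  finally show "(cmod (kap 1 0))\<^sup>2 = (2 * c * of_int A ^ 2 / sqrt (of_int E))\<^sup>2"
    using E_pos by (simp add: power_divide power_mult_distrib field_simps flip: power_mult)
qed (use c_pos A E_pos in auto)

lemma normal_form:
  obtains \<xi> :: "int \<Rightarrow> int \<Rightarrow> complex" and Q :: real where "0 < Q" "Q \<le> 2 * c\<^sup>2"
    "\<And>x1 y1 x2 y2. Im (cnj (\<xi> x2 y2) * \<xi> x1 y1) = of_int (x2 * y1 - x1 * y2)"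
    "\<And>x y. Im (\<xi> x y ^ 4) = 4 * of_int (form x y) / c"
    "\<And>r x1 y1 x2 y2. Q ^ r * Im (cnj (\<xi> x2 y2) * \<xi> x1 y1 *
       (\<Sum>j\<le>r. of_real (pade r j) * (\<xi> x1 y1 ^ 4) ^ (r - j) * cnj (\<xi> x1 y1 ^ 4) ^ j)) \<in> \<int>"
proof -
  define D where "D = sqrt (of_int E)"
  have D: "D > 0" using E_pos by (simp add: D_def)
  have A': "real_of_int A > 0" using A by simp
  \<comment> \<open>A fourth root of \<open>w\<close> makes \<open>Q * \<xi> ^ 4\<close> equal to
    \<open>2 * kap\<close> for \<open>Q = c * D\<close>. By \<open>norm_kap_1_0\<close> its squared
    modulus is then exactly the one giving covolume 1. The 2 before \<open>kap\<close> absorbs the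
    \<open>2 ^ r\<close> of \<open>pade_lin_Ints\<close>.\<close>
  define w where "w = 2 * kap 1 0 / of_real (c * D * of_int A ^ 4)"
  define \<rho> where "\<rho> = csqrt (csqrt w)"
  have "\<rho> ^ 4 = (\<rho>\<^sup>2)\<^sup>2" by (simp flip: power_mult)
  then have \<rho>4: "\<rho> ^ 4 = w" by (simp add: \<rho>_def)
  have "cmod w = 4 / (of_int A ^ 2 * D ^ 2)"
    using D A' c_pos by (simp add: w_def norm_divide norm_mult norm_power norm_kap_1_0 D_def [symmetric] field_simps eval_nat_numeral)
  then have "((cmod \<rho>)\<^sup>2)\<^sup>2 = (2 / (of_int A * D))\<^sup>2"
    by (simp add: \<rho>4 [symmetric] norm_power power_divide power_mult_distrib flip: power_mult)
  then have \<rho>2: "(cmod \<rho>)\<^sup>2 = 2 / (of_int A * D)"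
    using D A' by (intro power2_eq_imp_eq [of "(cmod \<rho>)\<^sup>2"]) auto
  define \<xi> where "\<xi> x y = \<rho> * lin x y" for x y
  define Q where "Q = c * D"
  have Q: "0 < Q" using c_pos D by (simp add: Q_def)
  have cross: "cnj (\<xi> x2 y2) * \<xi> x1 y1 = of_real (2 / (of_int A * D)) * (cnj (lin x2 y2) * lin x1 y1)"
    for x1 y1 x2 y2
  proof -
    have "cnj \<rho> * \<rho> = of_real (2 / (of_int A * D))"
      unfolding \<rho>2 [symmetric] by (simp only: complex_norm_square mult.commute)
    moreover have "cnj (\<xi> x2 y2) * \<xi> x1 y1 = (cnj \<rho> * \<rho>) * (cnj (lin x2 y2) * lin x1 y1)"
      unfolding \<xi>_def complex_cnj_mult by (simp only: mult_ac)
    ultimately show ?thesis by (simp only:)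
  qed
  have kap: "2 * kap x y = of_real Q * \<xi> x y ^ 4" for x y
  proof -
    have "of_real Q * \<xi> x y ^ 4 = 2 * (kap 1 0 * lin x y ^ 4) / of_int A ^ 4"
      using D c_pos A' by (simp add: \<xi>_def power_mult_distrib \<rho>4 w_def Q_def)
    also have "\<dots> = 2 * kap x y" using A unfolding kap_lin [symmetric] by simp
    finally show ?thesis ..
  qed
  show ?thesis
  proof (rule that [of Q \<xi>])
    show "Q \<le> 2 * c\<^sup>2"
      using sqrt_E_le c_pos by (simp add: Q_def D_def power2_eq_square)
    show "Im (cnj (\<xi> x2 y2) * \<xi> x1 y1) = of_int (x2 * y1 - x1 * y2)" for x1 y1 x2 y2
      unfolding cross Im_of_real_mult Re_Im_lin(2) D_def [symmetric] using D A' by simp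
    show "Im (\<xi> x y ^ 4) = 4 * of_int (form x y) / c" for x y
    proof -
      have "Q * Im (\<xi> x y ^ 4) = 2 * Im (kap x y)" using arg_cong [OF kap [of x y], of Im] by simp
      also have "\<dots> = 4 * of_int (form x y) * D" by (simp add: kap_def rt_def D_def)
      finally show ?thesis using D c_pos by (simp add: Q_def field_simps)
    qed
    show "Q ^ r * Im (cnj (\<xi> x2 y2) * \<xi> x1 y1 *
       (\<Sum>j\<le>r. of_real (pade r j) * (\<xi> x1 y1 ^ 4) ^ (r - j) * cnj (\<xi> x1 y1 ^ 4) ^ j)) \<in> \<int>" for r x1 y1 x2 y2
    proof -
      define S where "S = (\<Sum>j\<le>r. of_real (pade r j) * (\<xi> x1 y1 ^ 4) ^ (r - j) * cnj (\<xi> x1 y1 ^ 4) ^ j)"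
      have "2 ^ r * (\<Sum>j\<le>r. of_real (pade r j) * kap x1 y1 ^ (r - j) * cnj (kap x1 y1) ^ j)
         = (\<Sum>j\<le>r. of_real (pade r j) * (2 * kap x1 y1) ^ (r - j) * cnj (2 * kap x1 y1) ^ j)"
        unfolding sum_distrib_left
      proof (intro sum.cong refl)
        fix j assume "j \<in> {..r}"
        then have "(2::complex) ^ r = 2 ^ (r - j) * 2 ^ j" by (simp flip: power_add)
        then show "2 ^ r * (of_real (pade r j) * kap x1 y1 ^ (r - j) * cnj (kap x1 y1) ^ j)
           = of_real (pade r j) * (2 * kap x1 y1) ^ (r - j) * cnj (2 * kap x1 y1) ^ j"
          by (simp add: power_mult_distrib mult_ac)
      qed
      also have "\<dots> = of_real (Q ^ r) * S"
        unfolding S_def sum_distrib_left kap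
      proof (intro sum.cong refl)
        fix j assume "j \<in> {..r}"
        then have "complex_of_real (Q ^ r) = of_real Q ^ (r - j) * of_real Q ^ j" by (simp flip: power_add)
        then show "of_real (pade r j) * (of_real Q * \<xi> x1 y1 ^ 4) ^ (r - j) * cnj (of_real Q * \<xi> x1 y1 ^ 4) ^ j
           = of_real (Q ^ r) * (of_real (pade r j) * (\<xi> x1 y1 ^ 4) ^ (r - j) * cnj (\<xi> x1 y1 ^ 4) ^ j)"
          by (simp add: power_mult_distrib mult_ac)
      qed
      finally have eq: "2 ^ r * (\<Sum>j\<le>r. of_real (pade r j) * kap x1 y1 ^ (r - j) * cnj (kap x1 y1) ^ j)
         = of_real (Q ^ r) * S" .
      have "2 / (of_int A * D) * Im (cnj (lin x2 y2) * lin x1 y1 * (of_real (Q ^ r) * S)) \<in> \<int>"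
        using pade_lin_Ints [of x2 y2 x1 y1 r] unfolding eq D_def .
      moreover have "cnj (\<xi> x2 y2) * \<xi> x1 y1 * S = of_real (2 / (of_int A * D)) * (cnj (lin x2 y2) * lin x1 y1 * S)"
        unfolding cross by (simp only: mult.assoc)
      then have "Q ^ r * Im (cnj (\<xi> x2 y2) * \<xi> x1 y1 * S)
          = Q ^ r * (2 / (of_int A * D) * Im (cnj (lin x2 y2) * lin x1 y1 * S))"
        by (simp only: Im_of_real_mult)
      moreover have "Im (cnj (lin x2 y2) * lin x1 y1 * (of_real (Q ^ r) * S))
         = Q ^ r * Im (cnj (lin x2 y2) * lin x1 y1 * S)"
        by (simp only: mult.left_commute [of _ "of_real (Q ^ r)"] Im_of_real_mult)
      ultimately show ?thesis unfolding S_def [symmetric] by (simp only: mult.left_commute)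
    qed
  qed (rule Q)
qed

end

section \<open>Counting\<close>

text \<open>Of \<open>j + 4\<close> points, the one with largest first coordinate is set aside. By
  \<open>near_axis_large\<close> the others contain a large point, and its Pade multiples exclude
  the one set aside. The hypothesis on \<open>Q\<close> is what that exclusion needs at this
  size.\<close>

lemma class_card_le:
  fixes u \<alpha> :: "'a \<Rightarrow> real" and Q t :: real
  assumes t: "t \<ge> 1" and j: "j = 0 \<Longrightarrow> t ^ 4 \<ge> 2"
    and Q: "0 < Q" "Q \<le> 2/3 * (t ^ (4 * 3 ^ j - 2))\<^sup>2 * t ^ 8"
    and pt: "\<And>p. p \<in> S \<Longrightarrow> u p > 0 \<and> \<bar>\<alpha> p\<bar> \<le> pi/2 \<and> 0 < u p ^ 4 * \<bar>sin (\<alpha> p)\<bar>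
               \<and> u p ^ 4 * \<bar>sin (\<alpha> p)\<bar> \<le> 12 / (pi * t ^ 4)"
    and det: "\<And>p q. p \<in> S \<Longrightarrow> q \<in> S \<Longrightarrow> p \<noteq> q \<Longrightarrow> 1 \<le> \<bar>u p * u q * sin ((\<alpha> p - \<alpha> q) / 4)\<bar>"
    and int: "\<And>p q r. p \<in> S \<Longrightarrow> q \<in> S \<Longrightarrow> Q ^ r * u p ^ (4 * r + 1) * u q
                * (cos (\<alpha> q / 4) * pade_sin r (\<alpha> p) - sin (\<alpha> q / 4) * pade_cos r (\<alpha> p)) \<in> \<int>"
  shows "finite S \<and> card S \<le> j + 3"
proof (rule ccontr)
  assume "\<not> (finite S \<and> card S \<le> j + 3)"
  then have "\<exists>T. T \<subseteq> S \<and> finite T \<and> card T = Suc (j + 3)"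
  proof (cases "finite S")
    case True
    with \<open>\<not> (finite S \<and> card S \<le> j + 3)\<close> have "Suc (j + 3) \<le> card S" by simp
    then show ?thesis by (elim obtain_subset_with_card_n) blast
  next
    case False
    then show ?thesis using infinite_arbitrarily_large [of S "Suc (j + 3)"] by blast
  qed
  then obtain T where T: "T \<subseteq> S" "finite T" "card T = Suc (j + 3)" by blast
  define X Y where "X p = u p * cos (\<alpha> p / 4)" and "Y p = u p * sin (\<alpha> p / 4)" for p
  obtain p where p: "p \<in> T" "\<And>q. q \<in> T \<Longrightarrow> X q \<le> X p" "finite (T - {p})" "card (T - {p}) = j + 3"
    by (rule max_element [OF T(2,3), of X]) blast
  have near: "near_axis t (X p) (Y p)" if "p \<in> S" for p
    unfolding X_def Y_def using pt [OF that] t by (intro near_axis_polar) auto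
  have XY: "X p * Y q - X q * Y p = - (u p * u q * sin ((\<alpha> p - \<alpha> q) / 4))" for p q
    by (simp add: X_def Y_def diff_divide_distrib sin_diff algebra_simps)
  have "\<exists>q\<in>T - {p}. 27/10 * t ^ (4 * 3 ^ j - 1) \<le> X q"
  proof (rule near_axis_large [OF t p(3,4) j])
    show "near_axis t (X q) (Y q)" if "q \<in> T - {p}" for q using that T near by blast
    show "1 \<le> \<bar>X a * Y b - X b * Y a\<bar>" if "a \<in> T - {p}" "b \<in> T - {p}" "a \<noteq> b" for a b
      unfolding XY abs_minus_cancel using that T(1) by (intro det) auto
  qed
  then obtain q where q: "q \<in> T" "q \<noteq> p" "27/10 * t ^ (4 * 3 ^ j - 1) \<le> X q" by auto
  have S: "p \<in> S" "q \<in> S" using p q T by auto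
  \<comment> \<open>With one power of \<open>t\<close> split off, the bounds on \<open>X q\<close>
    and \<open>Q\<close> make both sides of the size condition multiples of
    \<open>(t * w) ^ 8\<close>.\<close>
  define w where "w = t ^ (4 * 3 ^ j - 2)"
  have w: "w \<ge> 1" unfolding w_def using t by (rule one_le_power)
  have "t ^ (4 * 3 ^ j - 1) = t * w"
  proof -
    have "(4 * 3 ^ j - 1 :: nat) = Suc (4 * 3 ^ j - 2)"
      using one_le_power [of "3::nat" j] by linarith
    then show ?thesis by (simp only: w_def power_Suc)
  qed
  then have Xq: "27/10 * (t * w) \<le> X q" using q(3) by simp
  have "X q \<le> u q * 1" unfolding X_def using pt [OF S(2)] by (intro mult_left_mono) auto
  with Xq have uq: "27/10 * (t * w) \<le> u q" by simp
  have "1 * 1 \<le> t * w" using t w by (intro mult_mono) auto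
  with uq have uq': "27/10 \<le> u q" by simp
  define L where "L = 12 / (pi * t ^ 4)"
  show False
  proof (rule pade_no_second_point [OF uq' _ Q(1)])
    \<comment> \<open>The point \<open>p\<close> maximises \<open>X\<close> and not the modulus, so
      the comparison is available only with the cosine on one side, as
      \<open>pade_no_second_point\<close> assumes it.\<close>
    have "u p * cos (\<alpha> p / 4) \<le> u p * 1" using pt [OF S(1)] by (intro mult_left_mono) auto
    then show "u q * cos (\<alpha> q / 4) \<le> u p" using p(2) [OF q(1)] by (simp add: X_def)
    have "L \<le> 12 / (3.1415 * 1)"
      unfolding L_def using t pi_approx by (intro divide_left_mono mult_mono) auto
    then show "L \<le> 382/100" by simp
    show "\<bar>\<alpha> q\<bar> \<le> pi/2" "0 < u q ^ 4 * \<bar>sin (\<alpha> q)\<bar>" "u q ^ 4 * \<bar>sin (\<alpha> q)\<bar> \<le> L"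
      "u p > 0" "\<bar>\<alpha> p\<bar> \<le> pi/2" "u p ^ 4 * \<bar>sin (\<alpha> p)\<bar> \<le> L"
      using pt [OF S(1)] pt [OF S(2)] unfolding L_def by blast+
    show "Q ^ r * u q ^ (4 * r + 1) * u p
                * (cos (\<alpha> p / 4) * pade_sin r (\<alpha> q) - sin (\<alpha> p / 4) * pade_cos r (\<alpha> q)) \<in> \<int>" for r
      using int S by blast
    show "sin ((\<alpha> q - \<alpha> p) / 4) \<noteq> 0" using det [OF S(2,1) q(2)] by auto
    have "L * t ^ 4 \<le> 12 / 3.14"
    proof -
      have "L * t ^ 4 = 12 / pi" unfolding L_def using t by simp
      also have "\<dots> \<le> 12 / 3.14" using pi_approx by (intro divide_left_mono) auto
      finally show ?thesis .
    qed
    then have "(L * t ^ 4) ^ 6 \<le> (12 / 3.14) ^ 6"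
      using t by (intro power_mono) (auto simp: L_def)
    then have Lt: "(L * t ^ 4) ^ 6 \<le> 3120" by (simp add: power_divide)
    have "4 * Q ^ 4 * L ^ 6 \<le> 4 * (2/3 * w\<^sup>2 * t ^ 8) ^ 4 * L ^ 6"
      by (intro mult_right_mono mult_left_mono power_mono Q(2) [folded w_def])
         (use Q(1) t in \<open>auto simp: L_def\<close>)
    also have "\<dots> = 64/81 * (t * w) ^ 8 * (L * t ^ 4) ^ 6"
    proof -
      have w8: "(w\<^sup>2) ^ 4 = w ^ 8" and t24: "(t ^ 4) ^ 6 = t ^ 24" and t32: "(t ^ 8) ^ 4 = t ^ 8 * t ^ 24"
        unfolding power_mult [symmetric] power_add [symmetric] by simp_all
      have "(2/3 :: real) ^ 4 = 16/81" by (simp add: power_divide)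
      then have "4 * (2/3 * w\<^sup>2 * t ^ 8) ^ 4 * L ^ 6 = 4 * (16/81 * w ^ 8 * (t ^ 8 * t ^ 24)) * L ^ 6"
        by (simp only: power_mult_distrib w8 t32)
      also have "\<dots> = 64/81 * (t ^ 8 * w ^ 8) * (L ^ 6 * t ^ 24)" by (simp only: mult_ac)
      also have "\<dots> = 64/81 * (t * w) ^ 8 * (L * t ^ 4) ^ 6"
        by (simp only: power_mult_distrib t24)
      finally show ?thesis .
    qed
    also have "\<dots> \<le> 64/81 * (t * w) ^ 8 * 3120"
      using Lt t w by (intro mult_left_mono) auto
    also have "\<dots> \<le> (99/100) ^ 7 * (27/10 * (t * w)) ^ 8"
    proof -
      have "0 \<le> (t * w) ^ 8" using t w by simp
      moreover have "64/81 * 3120 \<le> (99/100 :: real) ^ 7 * (27/10) ^ 8" by (simp add: power_divide)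
      ultimately have "64/81 * 3120 * (t * w) ^ 8 \<le> (99/100) ^ 7 * (27/10) ^ 8 * (t * w) ^ 8"
        by (rule mult_right_mono [rotated])
      then show ?thesis unfolding power_mult_distrib [of "27/10" "t * w"] by (simp only: mult_ac)
    qed
    also have "\<dots> \<le> (99/100) ^ 7 * u q ^ 8"
      using uq t w by (intro mult_left_mono power_mono) auto
    finally show "4 * Q ^ 4 * L ^ 6 \<le> (99/100) ^ 7 * u q ^ 8" .
  qed
qed

section \<open>Polar coordinates relative to the nearest multiple of pi/4\<close>

lemma polar_near_eighth:
  assumes "z \<noteq> 0"
  shows "\<exists>k \<alpha>. \<bar>\<alpha>\<bar> \<le> pi/2 \<and> z = of_real (cmod z) * cis ((of_int k * pi + \<alpha>) / 4)"
proof -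
  define k where "k = round (4 * Arg z / pi)"
  define \<alpha> where "\<alpha> = 4 * Arg z - of_int k * pi"
  have "\<bar>of_int k - 4 * Arg z / pi\<bar> \<le> 1/2" unfolding k_def by (rule of_int_round_abs_le)
  then have "\<bar>of_int k - 4 * Arg z / pi\<bar> * pi \<le> 1/2 * pi" by (intro mult_right_mono) auto
  moreover have "\<bar>of_int k - 4 * Arg z / pi\<bar> * pi = \<bar>(of_int k - 4 * Arg z / pi) * pi\<bar>"
    by (simp add: abs_mult)
  moreover have "(of_int k - 4 * Arg z / pi) * pi = - \<alpha>" by (simp add: \<alpha>_def left_diff_distrib)
  ultimately have "\<bar>\<alpha>\<bar> \<le> pi/2" by simp
  moreover have "z = of_real (cmod z) * cis ((of_int k * pi + \<alpha>) / 4)"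
    using rcis_cmod_Arg [of z] by (simp add: rcis_def \<alpha>_def)
  ultimately show ?thesis by blast
qed

lemma cis_int_pi: "cis (of_int k * pi) = of_real ((-1) powi k)"
proof -
  have "cis (of_int k * pi) = cis pi powi k" by (simp only: cis_power_int)
  also have "\<dots> = of_real ((-1) powi k)" unfolding cis_pi by simp
  finally show ?thesis .
qed

lemma abs_m1_powi: "\<bar>(-1 :: real) powi k\<bar> = 1"
  by (simp add: power_int_def)

lemma polar_pow4: "(of_real u * cis ((of_int k * pi + \<alpha>) / 4)) ^ 4 = of_real ((-1) powi k * u ^ 4) * cis \<alpha>"
proof -
  have "cis ((of_int k * pi + \<alpha>) / 4) ^ 4 = cis (of_int k * pi) * cis \<alpha>"
  proof -
    have "real 4 * ((of_int k * pi + \<alpha>) / 4) = of_int k * pi + \<alpha>" by simp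
    then show ?thesis by (simp only: Complex.DeMoivre cis_mult)
  qed
  then show ?thesis by (simp add: power_mult_distrib cis_int_pi)
qed

text \<open>Indices congruent modulo 4 belong to directions that differ by a multiple of
  \<open>pi\<close>, so the common direction cancels in \<open>cnj z2 * z1\<close> up to a sign;
  \<open>z1 ^ 4\<close> also retains only a sign and the small angle.\<close>

lemma polar_pade:
  assumes z1: "z1 = of_real u * cis ((of_int k * pi + \<alpha>) / 4)"
    and z2: "z2 = of_real v * cis ((of_int k' * pi + \<beta>) / 4)" and k: "k mod 4 = k' mod 4"
  shows "\<exists>e. \<bar>e\<bar> = 1 \<and> Im (cnj z2 * z1 * (\<Sum>j\<le>r. of_real (pade r j) * (z1 ^ 4) ^ (r - j) * cnj (z1 ^ 4) ^ j))
       = e * (u ^ (4 * r + 1) * v * (cos (\<beta>/4) * pade_sin r \<alpha> - sin (\<beta>/4) * pade_cos r \<alpha>))"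
proof -
  obtain l where l: "k = k' + 4 * l"
  proof -
    have "4 dvd k - k'" using k by (simp add: mod_eq_dvd_iff)
    then obtain l where "k - k' = 4 * l" by (elim dvdE)
    then show ?thesis by (intro that [of l]) simp
  qed
  define e1 e2 :: real where "e1 = (-1) powi k" and "e2 = (-1) powi l"
  have "cnj z2 * z1 = of_real (u * v) * (cis (- ((of_int k' * pi + \<beta>) / 4)) * cis ((of_int k * pi + \<alpha>) / 4))"
    by (simp add: z1 z2 cis_cnj)
  also have "cis (- ((of_int k' * pi + \<beta>) / 4)) * cis ((of_int k * pi + \<alpha>) / 4)
      = cis (of_int l * pi) * cis ((\<alpha> - \<beta>) / 4)"
  proof -
    have "- ((of_int k' * pi + \<beta>) / 4) + (of_int k * pi + \<alpha>) / 4 = of_int l * pi + (\<alpha> - \<beta>) / 4"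
      by (simp add: l field_simps)
    then show ?thesis by (simp only: cis_mult)
  qed
  finally have c: "cnj z2 * z1 = of_real (u * v * e2) * cis ((\<alpha> - \<beta>) / 4)"
    by (simp add: cis_int_pi e2_def)
  have z4: "z1 ^ 4 = of_real (e1 * u ^ 4) * cis \<alpha>" unfolding z1 e1_def by (rule polar_pow4)
  have cz4: "cnj (z1 ^ 4) = of_real (e1 * u ^ 4) * cis (- \<alpha>)" unfolding z4 by (simp add: cis_cnj)
  have term_eq: "cnj z2 * z1 * (of_real (pade r j) * (z1 ^ 4) ^ (r - j) * cnj (z1 ^ 4) ^ j)
     = of_real (e2 * e1 ^ r * (u ^ (4 * r + 1) * v)) * (of_real (pade r j) * cis ((real r + 1/4 - 2 * real j) * \<alpha> - \<beta>/4))"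
    if "j \<le> r" for j
  proof -
    have "(z1 ^ 4) ^ (r - j) * cnj (z1 ^ 4) ^ j
       = of_real ((e1 * u ^ 4) ^ (r - j) * (e1 * u ^ 4) ^ j) * (cis \<alpha> ^ (r - j) * cis (- \<alpha>) ^ j)"
      unfolding cz4 unfolding z4 by (simp add: power_mult_distrib mult_ac)
    also have "(e1 * u ^ 4) ^ (r - j) * (e1 * u ^ 4) ^ j = (e1 * u ^ 4) ^ r"
      using that by (simp flip: power_add)
    also have "cis \<alpha> ^ (r - j) * cis (- \<alpha>) ^ j = cis ((real r - 2 * real j) * \<alpha>)"
      using that by (simp add: Complex.DeMoivre cis_mult of_nat_diff algebra_simps)
    finally have "cnj z2 * z1 * (of_real (pade r j) * (z1 ^ 4) ^ (r - j) * cnj (z1 ^ 4) ^ j)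
      = of_real (u * v * e2 * (e1 * u ^ 4) ^ r) * (of_real (pade r j) * (cis ((\<alpha> - \<beta>) / 4) * cis ((real r - 2 * real j) * \<alpha>)))"
      unfolding c by (simp add: mult_ac)
    also have "cis ((\<alpha> - \<beta>) / 4) * cis ((real r - 2 * real j) * \<alpha>) = cis ((real r + 1/4 - 2 * real j) * \<alpha> - \<beta>/4)"
    proof -
      have "(\<alpha> - \<beta>) / 4 + (real r - 2 * real j) * \<alpha> = (real r + 1/4 - 2 * real j) * \<alpha> - \<beta>/4"
        by (simp add: field_simps)
      then show ?thesis by (simp only: cis_mult)
    qed
    also have "u * v * e2 * (e1 * u ^ 4) ^ r = e2 * e1 ^ r * (u ^ (4 * r + 1) * v)"
      by (simp add: power_mult_distrib mult_ac flip: power_mult)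
    finally show ?thesis .
  qed
  have "cnj z2 * z1 * (\<Sum>j\<le>r. of_real (pade r j) * (z1 ^ 4) ^ (r - j) * cnj (z1 ^ 4) ^ j)
    = of_real (e2 * e1 ^ r * (u ^ (4 * r + 1) * v))
       * (\<Sum>j\<le>r. of_real (pade r j) * cis ((real r + 1/4 - 2 * real j) * \<alpha> - \<beta>/4))"
    unfolding sum_distrib_left by (intro sum.cong refl term_eq) simp
  then have "Im (cnj z2 * z1 * (\<Sum>j\<le>r. of_real (pade r j) * (z1 ^ 4) ^ (r - j) * cnj (z1 ^ 4) ^ j))
    = e2 * e1 ^ r * (u ^ (4 * r + 1) * v) * (\<Sum>j\<le>r. pade r j * sin ((real r + 1/4 - 2 * real j) * \<alpha> - \<beta>/4))"
    by (simp only: Im_of_real_mult) simp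
  also have "(\<Sum>j\<le>r. pade r j * sin ((real r + 1/4 - 2 * real j) * \<alpha> - \<beta>/4))
     = cos (\<beta>/4) * pade_sin r \<alpha> - sin (\<beta>/4) * pade_cos r \<alpha>"
    unfolding pade_sin_def pade_cos_def sum_distrib_left sum_subtractf [symmetric]
    by (intro sum.cong refl) (simp only: sin_diff right_diff_distrib mult_ac)
  finally have "Im (cnj z2 * z1 * (\<Sum>j\<le>r. of_real (pade r j) * (z1 ^ 4) ^ (r - j) * cnj (z1 ^ 4) ^ j))
    = (e2 * e1 ^ r) * (u ^ (4 * r + 1) * v * (cos (\<beta>/4) * pade_sin r \<alpha> - sin (\<beta>/4) * pade_cos r \<alpha>))"
    by (simp only: mult.assoc)
  moreover have "\<bar>e2 * e1 ^ r\<bar> = 1" by (simp add: e1_def e2_def abs_mult power_abs abs_m1_powi)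
  ultimately show ?thesis by blast
qed

lemma coprime_proportional:
  fixes x1 y1 x2 y2 :: int
  assumes "coprime x1 y1" "coprime x2 y2" "y1 \<noteq> 0" "y2 \<noteq> 0" "x1 * y2 = x2 * y1"
  shows "(x2 = x1 \<and> y2 = y1) \<or> (x2 = - x1 \<and> y2 = - y1)"
proof -
  have "y1 dvd x1 * y2" using assms(5) by simp
  then have "y1 dvd y2" using assms(1) by (simp add: coprime_dvd_mult_right_iff coprime_commute)
  have "y2 dvd x2 * y1" using assms(5) by (metis dvd_triv_right)
  then have "y2 dvd y1" using assms(2) by (simp add: coprime_dvd_mult_right_iff coprime_commute)
  with \<open>y1 dvd y2\<close> have "\<bar>y1\<bar> = \<bar>y2\<bar>" by (intro zdvd_antisym_abs)
  then have "y2 = y1 \<or> y2 = - y1" by auto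
  then show ?thesis
  proof
    assume y: "y2 = y1"
    then show ?thesis using assms(3,5) by simp
  next
    assume y: "y2 = - y1"
    have "(x2 + x1) * y1 = 0" using assms(5) unfolding y by (simp add: algebra_simps)
    then show ?thesis using assms(3) y by auto
  qed
qed

text \<open>The argument of the logarithm exceeds 1/2 and hence 1/3, so the floor is at least -1 and
  its successor is a natural number, possibly 0.\<close>

lemma powr_floor_exponent:
  fixes \<epsilon> :: real
  assumes "0 < \<epsilon>" "\<epsilon> < 1/2"
  obtains j :: nat where "int j = \<lfloor>ln (1 / (2 * \<epsilon>) - 1/2) / ln 3\<rfloor> + 1" "1 / (2 * \<epsilon>) - 1/2 \<le> 3 ^ j"
proof -
  define y where "y = 1 / (2 * \<epsilon>) - 1/2"
  have y: "y > 1/2" using assms by (simp add: y_def field_simps)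
  define k where "k = \<lfloor>ln y / ln 3\<rfloor>"
  have "- ln 3 = ln (1/3 :: real)" by (simp add: ln_div)
  also have "\<dots> \<le> ln y" using y by (subst ln_le_cancel_iff) auto
  finally have "-1 \<le> ln y / ln 3" by (simp add: field_simps)
  then have k: "k \<ge> -1" by (simp add: k_def le_floor_iff)
  define j where "j = nat (k + 1)"
  have j: "int j = k + 1" using k by (simp add: j_def)
  have "ln y / ln 3 \<le> of_int (k + 1)" unfolding k_def by linarith
  also have "\<dots> = real j" by (simp add: j [symmetric])
  finally have "ln y \<le> real j * ln 3" by (simp add: field_simps)
  also have "\<dots> = ln (3 ^ j)" by (simp add: ln_realpow)
  finally have "y \<le> 3 ^ j" using y by (subst (asm) ln_le_cancel_iff) auto
  with j show ?thesis using that [of j] by (simp add: k_def y_def)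
qed

theorem theorem1p4:
  fixes a0 a1 a2 a3 a4 h :: int and \<epsilon> :: real
  assumes "quartic_irreducible_over_rat a0 a1 a2 a3 a4"
    and "quartic_I a0 a1 a2 a3 a4 > 0"
    and "quartic_J a0 a1 a2 a3 a4 = 0"
    and "\<forall>z::complex. quartic_form a0 a1 a2 a3 a4 z 1 = 0 \<longrightarrow> z \<in> \<real>"
    and "0 < \<epsilon>" and "\<epsilon> < 1 / 2"
    and "real_of_int h
           = sqrt 3 * real_of_int (quartic_I a0 a1 a2 a3 a4) powr (1 / 2 - \<epsilon>) / pi"
  shows "finite (thue_solutions a0 a1 a2 a3 a4 h) \<and>
         int (card (thue_solutions a0 a1 a2 a3 a4 h))
           \<le> 4 * \<lfloor>ln (1 / (2 * \<epsilon>) - 1 / 2) / ln 3\<rfloor> + 16"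
proof -
  define I where "I = real_of_int (quartic_I a0 a1 a2 a3 a4)"
  have I1: "I \<ge> 1" using assms(2) by (simp add: I_def)
  have F0: "quartic_form a0 a1 a2 a3 a4 x y \<noteq> (0::int)" if "x \<noteq> 0 \<or> y \<noteq> 0" for x y
    using quartic_form_nonzero [OF assms(1) that] .
  have "a0 \<noteq> 0" using F0 [of 1 0] by (simp add: quartic_form_def)
  have hess: "3 * a1 ^ 2 - 8 * a0 * a2 > 0"
    by (rule quartic_hessian_pos [OF \<open>a0 \<noteq> 0\<close> assms(2,4)])
  obtain A B C where ABC: "A > 0" "gcd (gcd A C) (A + B + C) = 1"
    "12 * C * a0 - 3 * B * a1 + 2 * A * a2 = 0"
    "6 * C * a1 - 4 * B * a2 + 6 * A * a3 = 0"
    "2 * C * a2 - 3 * B * a3 + 12 * A * a4 = 0"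
    by (rule apolar_quadratic [OF assms(3) hess])
  interpret apolar_pair a0 a1 a2 a3 a4 A B C
    by unfold_locales (use ABC assms(2) hess in auto)
  obtain \<xi> Q where Q: "0 < Q" "Q \<le> 2 * c\<^sup>2"
    and det: "\<And>x1 y1 x2 y2. Im (cnj (\<xi> x2 y2) * \<xi> x1 y1) = of_int (x2 * y1 - x1 * y2)"
    and im4: "\<And>x y. Im (\<xi> x y ^ 4) = 4 * of_int (form x y) / c"
    and int: "\<And>r x1 y1 x2 y2. Q ^ r * Im (cnj (\<xi> x2 y2) * \<xi> x1 y1 *
       (\<Sum>j\<le>r. of_real (pade r j) * (\<xi> x1 y1 ^ 4) ^ (r - j) * cnj (\<xi> x1 y1 ^ 4) ^ j)) \<in> \<int>"
    by (rule normal_form) blast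
  obtain j where j: "int j = \<lfloor>ln (1 / (2 * \<epsilon>) - 1/2) / ln 3\<rfloor> + 1" "1 / (2 * \<epsilon>) - 1/2 \<le> 3 ^ j"
    by (rule powr_floor_exponent [OF assms(5,6)])
  \<comment> \<open>The exponent is chosen so that the hypothesis on \<open>h\<close> becomes
    \<open>4 * h / c = 12 / (pi * t ^ 4)\<close>, the form used by
    \<open>near_axis_polar\<close>.\<close>
  define t where "t = I powr (\<epsilon> / 4)"
  have t: "t \<ge> 1" using I1 assms(5) by (simp add: t_def ge_one_powr_ge_zero)
  have tpow: "t ^ n = I powr (\<epsilon> / 4 * real n)" for n
    using I1 by (simp add: t_def powr_powr flip: powr_realpow)
  have h: "real_of_int h * pi = sqrt 3 * I powr (1/2 - \<epsilon>)"
    using assms(7) by (simp add: I_def)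
  have "c\<^sup>2 = I / 3" using c_sq by (simp add: I_def)
  have c: "c = sqrt I / sqrt 3" by (simp add: c_def I_def real_sqrt_divide)
  have L: "4 * real_of_int h / c = 12 / (pi * t ^ 4)"
  proof -
    have "I powr (1/2 - \<epsilon>) = sqrt I / t ^ 4"
      using I1 by (simp add: tpow powr_diff powr_half_sqrt)
    then have "real_of_int h * pi = sqrt 3 * (sqrt I / t ^ 4)" using h by (simp only:)
    then have "real_of_int h = sqrt 3 * (sqrt I / t ^ 4) / pi"
      by (rule nonzero_eq_divide_eq [THEN iffD2, OF pi_neq_zero])
    moreover have "4 * (a * (b / d) / p) / (b / a) = 4 * (a * a) / (p * d)" if "b \<noteq> 0" for a b d p :: real
      using that by (simp add: field_simps)
    ultimately have "4 * real_of_int h / c = 4 * (sqrt 3 * sqrt 3) / (pi * t ^ 4)"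
      using I1 unfolding c by simp
    then show ?thesis by simp
  qed
  have "h > 0"
  proof -
    have "real_of_int h * pi > 0" unfolding h using I1 by simp
    then show ?thesis by (simp add: zero_less_mult_iff)
  qed
  \<comment> \<open>The power of \<open>t\<close> equals
    \<open>I powr (\<epsilon> * (2 * 3 ^ j + 1))\<close>, and the choice of \<open>j\<close> makes
    this exponent at least 1, while \<open>Q \<le> 2/3 * I\<close>.\<close>
  have Qle: "Q \<le> 2/3 * (t ^ (4 * 3 ^ j - 2))\<^sup>2 * t ^ 8"
  proof -
    have "(t ^ (4 * 3 ^ j - 2))\<^sup>2 * t ^ 8 = t ^ (8 * 3 ^ j + 4)"
    proof -
      have "(4 * 3 ^ j - 2) * 2 + 8 = (8 * 3 ^ j + 4 :: nat)"
        using one_le_power [of "3::nat" j] by linarith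
      then show ?thesis by (simp only: power_mult [symmetric] power_add [symmetric])
    qed
    also have "\<dots> = I powr (\<epsilon> * (2 * 3 ^ j + 1))" unfolding tpow by (simp add: algebra_simps)
    also have "\<dots> \<ge> I powr 1"
    proof (rule powr_mono [OF _ I1])
      have "2 * \<epsilon> * (1 / (2 * \<epsilon>) - 1/2) \<le> 2 * \<epsilon> * 3 ^ j"
        using j(2) assms(5) by (intro mult_left_mono) auto
      moreover have "2 * \<epsilon> * (1 / (2 * \<epsilon>) - 1/2) = 1 - \<epsilon>"
        using assms(5) by (simp add: field_simps)
      ultimately show "1 \<le> \<epsilon> * (2 * 3 ^ j + 1)" by (simp add: algebra_simps)
    qed
    finally show ?thesis using Q(2) I1 \<open>c\<^sup>2 = I / 3\<close> by simp
  qed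
  \<comment> \<open>Here \<open>j = 0\<close> forces \<open>\<epsilon> \<ge> 1/3\<close>. As a
    positive integer \<open>h\<close> is at least 1, so \<open>I powr (1/2 - \<epsilon>)\<close> is
    at least sqrt 3, and \<open>t ^ 2\<close> dominates this power.\<close>
  have t4: "t ^ 4 \<ge> 2" if "j = 0"
  proof -
    have "1 / (2 * \<epsilon>) \<le> 3/2" using j(2) that by simp
    then have "1/2 - \<epsilon> \<le> \<epsilon> / 2" using assms(5) by (simp add: field_simps)
    have "1 * 3 \<le> real_of_int h * pi"
      using \<open>h > 0\<close> pi_gt3 by (intro mult_mono) auto
    then have "3 \<le> sqrt 3 * I powr (1/2 - \<epsilon>)" by (simp add: h)
    moreover have "sqrt 3 * I powr (1/2 - \<epsilon>) \<le> sqrt 3 * t ^ 2"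
      unfolding tpow using \<open>1/2 - \<epsilon> \<le> \<epsilon> / 2\<close> I1 by (intro mult_left_mono powr_mono) auto
    ultimately have "3 \<le> sqrt 3 * t ^ 2" by linarith
    then have "3\<^sup>2 \<le> (sqrt 3 * t ^ 2)\<^sup>2" by (intro power_mono) auto
    then show ?thesis by (simp add: power_mult_distrib flip: power_mult)
  qed
  obtain K \<alpha> where K: "\<And>z. z \<noteq> 0 \<Longrightarrow> \<bar>\<alpha> z\<bar> \<le> pi/2"
    "\<And>z. z \<noteq> 0 \<Longrightarrow> z = of_real (cmod z) * cis ((of_int (K z) * pi + \<alpha> z) / 4)"
    using polar_near_eighth by metis
  define Z where "Z p = \<xi> (fst p) (snd p)" for p
  define W where "W = {p :: int \<times> int. coprime (fst p) (snd p) \<and> snd p \<noteq> 0 \<and> \<bar>form (fst p) (snd p)\<bar> \<le> h}"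
  \<comment> \<open>One representative per pair: distinct representatives are never opposite, so
    their determinant is a nonzero integer.\<close>
  define rep where "rep s = (SOME p. p \<in> W \<and> s = {p, - p})" for s :: "(int \<times> int) set"
  define G where "G = thue_solutions a0 a1 a2 a3 a4 h"
  have rep: "rep s \<in> W \<and> s = {rep s, - rep s}" if "s \<in> G" for s
  proof -
    have "\<exists>p. p \<in> W \<and> s = {p, - p}"
      using that by (auto simp: G_def thue_solutions_def W_def)
    then show ?thesis unfolding rep_def by (rule someI_ex)
  qed
  have inj: "inj_on rep G" by (rule inj_onI) (metis rep)
  \<comment> \<open>Adding 4 to \<open>K\<close> turns the direction by \<open>pi\<close>, so the
    residue modulo 4 records a line through the origin.\<close>
  define R where "R i = {p \<in> rep ` G. K (Z p) mod 4 = i}" for i :: int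
  have Z0: "Im (Z p ^ 4) \<noteq> 0" "Z p \<noteq> 0" if "p \<in> W" for p
  proof -
    have "form (fst p) (snd p) \<noteq> 0" using that F0 by (auto simp: W_def)
    then show "Im (Z p ^ 4) \<noteq> 0" using c_pos by (simp add: Z_def im4)
    then show "Z p \<noteq> 0" by auto
  qed
  have RW: "p \<in> W" if "p \<in> R i" for p i using that rep by (auto simp: R_def)
  have in_class: "finite (R i) \<and> card (R i) \<le> j + 3" for i
  proof (rule class_card_le [where u = "\<lambda>p. cmod (Z p)" and \<alpha> = "\<lambda>p. \<alpha> (Z p)", OF t t4 Q(1) Qle])
    fix p assume p: "p \<in> R i"
    note W = RW [OF p]
    have abs4: "cmod (Z p) ^ 4 * \<bar>sin (\<alpha> (Z p))\<bar> = \<bar>Im (Z p ^ 4)\<bar>"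
    proof -
      have "Z p ^ 4 = of_real ((-1) powi K (Z p) * cmod (Z p) ^ 4) * cis (\<alpha> (Z p))"
        by (subst K(2) [OF Z0(2) [OF W]]) (rule polar_pow4)
      then have "Im (Z p ^ 4) = (-1) powi K (Z p) * cmod (Z p) ^ 4 * sin (\<alpha> (Z p))"
        by (simp only: Im_of_real_mult cis.sel)
      then show ?thesis by (simp only: abs_mult abs_m1_powi power_abs abs_norm_cancel mult_1_left)
    qed
    have "\<bar>Im (Z p ^ 4)\<bar> \<le> 4 * real_of_int h / c"
    proof -
      have "\<bar>form (fst p) (snd p)\<bar> \<le> h" using W by (simp add: W_def)
      then have "\<bar>real_of_int (form (fst p) (snd p))\<bar> \<le> of_int h"
        unfolding of_int_abs [symmetric] of_int_le_iff .
      then show ?thesis using c_pos by (simp add: Z_def im4 abs_mult divide_right_mono)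
    qed
    then show "cmod (Z p) > 0 \<and> \<bar>\<alpha> (Z p)\<bar> \<le> pi/2 \<and> 0 < cmod (Z p) ^ 4 * \<bar>sin (\<alpha> (Z p))\<bar>
               \<and> cmod (Z p) ^ 4 * \<bar>sin (\<alpha> (Z p))\<bar> \<le> 12 / (pi * t ^ 4)"
      using Z0 [OF W] K(1) [OF Z0(2) [OF W]] unfolding abs4 L by simp
  next
    fix p q assume p: "p \<in> R i" and q: "q \<in> R i"
    have k: "K (Z p) mod 4 = K (Z q) mod 4" using p q by (simp add: R_def)
    note pol = polar_pade [OF K(2) [OF Z0(2) [OF RW [OF p]]] K(2) [OF Z0(2) [OF RW [OF q]]] k]
    {
      fix r
      obtain e where e: "\<bar>e\<bar> = 1" "Im (cnj (Z q) * Z p * (\<Sum>j\<le>r. of_real (pade r j) * (Z p ^ 4) ^ (r - j) * cnj (Z p ^ 4) ^ j))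
       = e * (cmod (Z p) ^ (4 * r + 1) * cmod (Z q) * (cos (\<alpha> (Z q)/4) * pade_sin r (\<alpha> (Z p)) - sin (\<alpha> (Z q)/4) * pade_cos r (\<alpha> (Z p))))"
        using pol [of r] by blast
      define N where "N = Q ^ r * cmod (Z p) ^ (4 * r + 1) * cmod (Z q)
            * (cos (\<alpha> (Z q)/4) * pade_sin r (\<alpha> (Z p)) - sin (\<alpha> (Z q)/4) * pade_cos r (\<alpha> (Z p)))"
      have "Q ^ r * (e * (cmod (Z p) ^ (4 * r + 1) * cmod (Z q) * (cos (\<alpha> (Z q)/4) * pade_sin r (\<alpha> (Z p)) - sin (\<alpha> (Z q)/4) * pade_cos r (\<alpha> (Z p))))) \<in> \<int>"
        unfolding e(2) [symmetric] unfolding Z_def by (rule int)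
      then have "e * N \<in> \<int>" by (simp only: N_def mult_ac)
      moreover have "e = 1 \<or> e = -1" using e(1) by linarith
      ultimately have "N \<in> \<int>" using Ints_minus by fastforce
      then show "Q ^ r * cmod (Z p) ^ (4 * r + 1) * cmod (Z q)
            * (cos (\<alpha> (Z q)/4) * pade_sin r (\<alpha> (Z p)) - sin (\<alpha> (Z q)/4) * pade_cos r (\<alpha> (Z p))) \<in> \<int>"
        by (simp only: N_def)
    }
    assume "p \<noteq> q"
    have "fst q * snd p \<noteq> fst p * snd q"
    proof
      assume eq: "fst q * snd p = fst p * snd q"
      have "(fst q = fst p \<and> snd q = snd p) \<or> (fst q = - fst p \<and> snd q = - snd p)"
        using RW [OF p] RW [OF q] eq by (intro coprime_proportional) (auto simp: W_def)
      then have "q = p \<or> q = - p" by (auto simp: prod_eq_iff)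
      then have "q = - p" using \<open>p \<noteq> q\<close> by auto
      moreover obtain s s' where "s \<in> G" "s' \<in> G" "p = rep s" "q = rep s'" using p q by (auto simp: R_def)
      ultimately have "s = {p, - p}" "s' = {- p, - (- p)}" using rep [of s] rep [of s'] by (simp, metis)
      then have "s = s'" by auto
      then show False using \<open>p \<noteq> q\<close> \<open>p = rep s\<close> \<open>q = rep s'\<close> by simp
    qed
    then have "1 \<le> \<bar>fst q * snd p - fst p * snd q\<bar>" by linarith
    then have "real_of_int 1 \<le> real_of_int \<bar>fst q * snd p - fst p * snd q\<bar>"
      by (simp only: of_int_le_iff)
    then have "1 \<le> \<bar>real_of_int (fst q * snd p - fst p * snd q)\<bar>"
      by (simp only: of_int_1 of_int_abs)
    also have "\<dots> = \<bar>Im (cnj (Z q) * Z p)\<bar>" unfolding Z_def det ..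
    also have "\<dots> = \<bar>cmod (Z p) * cmod (Z q) * sin ((\<alpha> (Z p) - \<alpha> (Z q)) / 4)\<bar>"
    proof -
      \<comment> \<open>For \<open>r = 0\<close> the Pade sum is 1 and \<open>pol\<close> describes
        the determinant itself.\<close>
      obtain e where "\<bar>e\<bar> = 1" "Im (cnj (Z q) * Z p)
         = e * (cmod (Z p) * cmod (Z q) * (cos (\<alpha> (Z q)/4) * sin (\<alpha> (Z p)/4) - sin (\<alpha> (Z q)/4) * cos (\<alpha> (Z p)/4)))"
        using pol [of 0] by (auto simp: pade_def pade_sin_def pade_cos_def mult.commute)
      moreover have "cos (\<alpha> (Z q)/4) * sin (\<alpha> (Z p)/4) - sin (\<alpha> (Z q)/4) * cos (\<alpha> (Z p)/4) = sin ((\<alpha> (Z p) - \<alpha> (Z q)) / 4)"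
        by (simp add: diff_divide_distrib sin_diff mult.commute)
      ultimately show ?thesis by (simp only: abs_mult mult_1_left)
    qed
    finally show "1 \<le> \<bar>cmod (Z p) * cmod (Z q) * sin ((\<alpha> (Z p) - \<alpha> (Z q)) / 4)\<bar>" .
  qed
  have RU: "rep ` G = (\<Union>i\<in>{0..<4}. R i)"
    by (auto simp: R_def)
  have fin: "finite (rep ` G)" unfolding RU using in_class by auto
  then have finG: "finite G" using inj by (rule finite_imageD)
  have "card G = card (rep ` G)" using inj by (simp add: card_image)
  also have "\<dots> \<le> (\<Sum>i\<in>{0..<4}. card (R i))" unfolding RU by (rule card_UN_le) simp
  also have "\<dots> \<le> (\<Sum>i\<in>{0..<4::int}. j + 3)" using in_class by (intro sum_mono) auto
  finally have "card G \<le> 4 * (j + 3)" by simp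
  then have "int (card G) \<le> int (4 * (j + 3))" by (simp only: of_nat_le_iff)
  then show ?thesis using finG j(1) unfolding G_def by simp
qed

end
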